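(* Let $\mathcal{L}$ be a closed real-valued logic. Then $\mathcal{L}$ is Product logic $\mathbf{\Pi}$ if, and only if, $\mathcal{L}$ and every real-valued logic that is an extension of $\mathcal{L}$ and is not classical logic fail both principle (P1) and principle (P2).
   Context: Formulas $\mathrm{Form}$ are built from countably many propositional variables $X_1,X_2,\dots$ with primitive connectives $\to$, $\&$, $\bot$; abbreviations: $\neg\alpha:=\alpha\to\bot$, $\alpha\wedge\beta:=\alpha\&(\alpha\to\beta)$, $\alpha\vee\beta:=((\alpha\to\beta)\to\beta)\wedge((\beta\to\alpha)\to\alpha)$, $\alpha\leftrightarrow\beta:=(\alpha\to\beta)\&(\beta\to\alpha)$. $\mathbf{BL}$ is H\'ajek's Basic Logic (the logic of all continuous t-norms and their residua). An extension of a logic is a consistent set of formulas containing it, closed under the $\mathbf{BL}$ consequence relation and under substitutions. A t-norm here is a continuous, associative, commutative binary operation $*$ on $[0,1]$ with neutral element $1$, non-decreasing in each argument; its residuum is $a\to_* b:=\max\{c\in[0,1]: a*c\le b\}$. An algebra of truth values $T_*$ is a subalgebra (containing $0,1$, closed under $*$ and $\to_*$) of a BL-algebra $([0,1],*,\to_*,0)$ with $*$ a continuous t-norm; valuations $\mu:\mathrm{Form}\to T_*$ interpret $\&$ by $*$, $\to$ by $\to_*$, $\bot$ by $0$. $\mathcal{L}$ is a real-valued logic if $\mathcal{L}$ is an extension of $\mathbf{BL}$ and there is an algebra of truth values $T_*$ such that $\mathcal{L}$ is complete with respect to valuations into $T_*$ ($\vdash_{\mathcal{L}}\alpha$ iff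 $\mu(\alpha)=1$ for all such $\mu$); such $T_*$ induces $\mathcal{L}$. $\mathcal{L}$ is closed if some algebra of truth values inducing it has underlying set closed in the Euclidean topology of $[0,1]$. Classical logic is the logic induced by $\{0,1\}$. Product logic $\mathbf{\Pi}$ is $\mathbf{BL}$ extended by the schema $\neg\varphi\vee((\varphi\to(\varphi\&\psi))\to\psi)$ (equivalently, the logic induced by the product t-norm $x\times y=xy$ on $[0,1]$). Principle (P1) for $\mathcal{L}$: for every $T_*$ inducing $\mathcal{L}$ and all $\alpha,\beta$, $\vdash_{\mathcal{L}}\alpha\leftrightarrow\beta$ iff for every valuation $\mu$ into $T_*$, ($\mu(\alpha)=1\iff\mu(\beta)=1$). Principle (P2) for $\mathcal{L}$: for every $T_*$ inducing $\mathcal{L}$ and all valuations $\mu\ne\nu$ into $T_*$, there is $\alpha$ with $\mu(\alpha)>0$ and $\nu(\alpha)=0$. *)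

theory Defs
  imports "HOL-Analysis.Analysis"
begin

datatype form =
    Var nat
  | Imp form form  (infixr \<open>\<^bold>\<rightarrow>\<close> 55)
  | Conj form form  (infixr \<open>\<^bold>&\<close> 60)
  | Falsum  (\<open>\<^bold>\<bottom>\<close>)

definition Neg :: "form \<Rightarrow> form"  (\<open>\<^bold>\<not> _\<close> [70] 70)
  where "\<^bold>\<not> \<alpha> = \<alpha> \<^bold>\<rightarrow> \<^bold>\<bottom>"

definition WConj :: "form \<Rightarrow> form \<Rightarrow> form"  (infixr \<open>\<^bold>\<and>\<close> 60)
  where "\<alpha> \<^bold>\<and> \<beta> = \<alpha> \<^bold>& (\<alpha> \<^bold>\<rightarrow> \<beta>)"

definition WDisj :: "form \<Rightarrow> form \<Rightarrow> form"  (infixr \<open>\<^bold>\<or>\<close> 58)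
  where "\<alpha> \<^bold>\<or> \<beta> = ((\<alpha> \<^bold>\<rightarrow> \<beta>) \<^bold>\<rightarrow> \<beta>) \<^bold>\<and> ((\<beta> \<^bold>\<rightarrow> \<alpha>) \<^bold>\<rightarrow> \<alpha>)"

definition Iff :: "form \<Rightarrow> form \<Rightarrow> form"  (infix \<open>\<^bold>\<leftrightarrow>\<close> 53)
  where "\<alpha> \<^bold>\<leftrightarrow> \<beta> = (\<alpha> \<^bold>\<rightarrow> \<beta>) \<^bold>& (\<beta> \<^bold>\<rightarrow> \<alpha>)"

primrec subst_form :: "(nat \<Rightarrow> form) \<Rightarrow> form \<Rightarrow> form" where
  "subst_form \<sigma> (Var n) = \<sigma> n"
| "subst_form \<sigma> (\<alpha> \<^bold>\<rightarrow> \<beta>) = subst_form \<sigma> \<alpha> \<^bold>\<rightarrow> subst_form \<sigma> \<beta>"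
| "subst_form \<sigma> (\<alpha> \<^bold>& \<beta>) = subst_form \<sigma> \<alpha> \<^bold>& subst_form \<sigma> \<beta>"
| "subst_form \<sigma> \<^bold>\<bottom> = \<^bold>\<bottom>"

text \<open>The axiom schemata (A1)--(A7) of Hajek's Basic Logic; modus ponens is the only rule.\<close>

inductive BL_axiom :: "form \<Rightarrow> bool" where
  A1: "BL_axiom ((\<phi> \<^bold>\<rightarrow> \<psi>) \<^bold>\<rightarrow> ((\<psi> \<^bold>\<rightarrow> \<theta>) \<^bold>\<rightarrow> (\<phi> \<^bold>\<rightarrow> \<theta>)))"
| A2: "BL_axiom ((\<phi> \<^bold>& \<psi>) \<^bold>\<rightarrow> \<phi>)"
| A3: "BL_axiom ((\<phi> \<^bold>& \<psi>) \<^bold>\<rightarrow> (\<psi> \<^bold>& \<phi>))"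
| A4: "BL_axiom ((\<phi> \<^bold>& (\<phi> \<^bold>\<rightarrow> \<psi>)) \<^bold>\<rightarrow> (\<psi> \<^bold>& (\<psi> \<^bold>\<rightarrow> \<phi>)))"
| A5a: "BL_axiom ((\<phi> \<^bold>\<rightarrow> (\<psi> \<^bold>\<rightarrow> \<theta>)) \<^bold>\<rightarrow> ((\<phi> \<^bold>& \<psi>) \<^bold>\<rightarrow> \<theta>))"
| A5b: "BL_axiom (((\<phi> \<^bold>& \<psi>) \<^bold>\<rightarrow> \<theta>) \<^bold>\<rightarrow> (\<phi> \<^bold>\<rightarrow> (\<psi> \<^bold>\<rightarrow> \<theta>)))"
| A6: "BL_axiom (((\<phi> \<^bold>\<rightarrow> \<psi>) \<^bold>\<rightarrow> \<theta>) \<^bold>\<rightarrow> (((\<psi> \<^bold>\<rightarrow> \<phi>) \<^bold>\<rightarrow> \<theta>) \<^bold>\<rightarrow> \<theta>))"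
| A7: "BL_axiom (\<^bold>\<bottom> \<^bold>\<rightarrow> \<phi>)"

inductive BL_consequence :: "form set \<Rightarrow> form \<Rightarrow> bool"  (infix \<open>\<turnstile>\<^sub>B\<^sub>L\<close> 50)
  for \<Gamma> :: "form set" where
  hyp: "\<alpha> \<in> \<Gamma> \<Longrightarrow> \<Gamma> \<turnstile>\<^sub>B\<^sub>L \<alpha>"
| ax: "BL_axiom \<alpha> \<Longrightarrow> \<Gamma> \<turnstile>\<^sub>B\<^sub>L \<alpha>"
| mp: "\<Gamma> \<turnstile>\<^sub>B\<^sub>L \<alpha> \<Longrightarrow> \<Gamma> \<turnstile>\<^sub>B\<^sub>L \<alpha> \<^bold>\<rightarrow> \<beta> \<Longrightarrow> \<Gamma> \<turnstile>\<^sub>B\<^sub>L \<beta>"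

definition BL :: "form set"
  where "BL = {\<alpha>. {} \<turnstile>\<^sub>B\<^sub>L \<alpha>}"

definition product_logic :: "form set"
  where "product_logic =
    {\<alpha>. {\<^bold>\<not> \<phi> \<^bold>\<or> ((\<phi> \<^bold>\<rightarrow> (\<phi> \<^bold>& \<psi>)) \<^bold>\<rightarrow> \<psi>) |\<phi> \<psi>. True} \<turnstile>\<^sub>B\<^sub>L \<alpha>}"

definition extension_of :: "form set \<Rightarrow> form set \<Rightarrow> bool"
  where "extension_of M L \<longleftrightarrow>
    L \<subseteq> M \<and> M \<noteq> UNIV \<and>
    (\<forall>\<alpha>. M \<turnstile>\<^sub>B\<^sub>L \<alpha> \<longrightarrow> \<alpha> \<in> M) \<and>
    (\<forall>\<sigma>. \<forall>\<alpha>\<in>M. subst_form \<sigma> \<alpha> \<in> M)"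

text \<open>Operations on the unit interval are total functions on the reals, of which only the
  restriction to the unit square matters.\<close>

definition tnorm :: "(real \<Rightarrow> real \<Rightarrow> real) \<Rightarrow> bool"
  where "tnorm s \<longleftrightarrow>
    (\<forall>a\<in>{0..1}. \<forall>b\<in>{0..1}. s a b \<in> {0..1}) \<and>
    continuous_on ({0..1} \<times> {0..1}) (\<lambda>(a, b). s a b) \<and>
    (\<forall>a\<in>{0..1}. \<forall>b\<in>{0..1}. \<forall>c\<in>{0..1}. s (s a b) c = s a (s b c)) \<and>
    (\<forall>a\<in>{0..1}. \<forall>b\<in>{0..1}. s a b = s b a) \<and>
    (\<forall>a\<in>{0..1}. s a 1 = a \<and> s 1 a = a) \<and>
    (\<forall>a\<in>{0..1}. \<forall>b\<in>{0..1}. \<forall>c\<in>{0..1}. a \<le> b \<longrightarrow> s a c \<le> s b c \<and> s c a \<le> s c b)"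

definition residuum :: "(real \<Rightarrow> real \<Rightarrow> real) \<Rightarrow> real \<Rightarrow> real \<Rightarrow> real"
  where "residuum s a b = (GREATEST c. c \<in> {0..1} \<and> s a c \<le> b)"

definition truth_algebra :: "(real \<Rightarrow> real \<Rightarrow> real) \<Rightarrow> real set \<Rightarrow> bool"
  where "truth_algebra s T \<longleftrightarrow>
    tnorm s \<and> T \<subseteq> {0..1} \<and> 0 \<in> T \<and> 1 \<in> T \<and>
    (\<forall>a\<in>T. \<forall>b\<in>T. s a b \<in> T \<and> residuum s a b \<in> T)"

definition valuation :: "(real \<Rightarrow> real \<Rightarrow> real) \<Rightarrow> real set \<Rightarrow> (form \<Rightarrow> real) \<Rightarrow> bool"
  where "valuation s T \<mu> \<longleftrightarrow>
    (\<forall>\<alpha>. \<mu> \<alpha> \<in> T) \<and>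
    (\<forall>\<alpha> \<beta>. \<mu> (\<alpha> \<^bold>& \<beta>) = s (\<mu> \<alpha>) (\<mu> \<beta>)) \<and>
    (\<forall>\<alpha> \<beta>. \<mu> (\<alpha> \<^bold>\<rightarrow> \<beta>) = residuum s (\<mu> \<alpha>) (\<mu> \<beta>)) \<and>
    \<mu> \<^bold>\<bottom> = 0"

definition logic_of :: "(real \<Rightarrow> real \<Rightarrow> real) \<Rightarrow> real set \<Rightarrow> form set"
  where "logic_of s T = {\<alpha>. \<forall>\<mu>. valuation s T \<mu> \<longrightarrow> \<mu> \<alpha> = 1}"

definition induces :: "(real \<Rightarrow> real \<Rightarrow> real) \<Rightarrow> real set \<Rightarrow> form set \<Rightarrow> bool"
  where "induces s T L \<longleftrightarrow> truth_algebra s T \<and> L = logic_of s T"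

definition real_valued_logic :: "form set \<Rightarrow> bool"
  where "real_valued_logic L \<longleftrightarrow> extension_of L BL \<and> (\<exists>s T. induces s T L)"

definition closed_logic :: "form set \<Rightarrow> bool"
  where "closed_logic L \<longleftrightarrow> (\<exists>s T. induces s T L \<and> closedin (top_of_set {0..1}) T)"

text \<open>All t-norms coincide on \<open>{0, 1}\<close>, so the choice of \<open>min\<close> is immaterial.\<close>

definition classical_logic :: "form set"
  where "classical_logic = logic_of min {0, 1}"

definition P1 :: "form set \<Rightarrow> bool"
  where "P1 L \<longleftrightarrow>
    (\<forall>s T. induces s T L \<longrightarrow>
      (\<forall>\<alpha> \<beta>. \<alpha> \<^bold>\<leftrightarrow> \<beta> \<in> L \<longleftrightarrow>
        (\<forall>\<mu>. valuation s T \<mu> \<longrightarrow> (\<mu> \<alpha> = 1 \<longleftrightarrow> \<mu> \<beta> = 1))))"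

definition P2 :: "form set \<Rightarrow> bool"
  where "P2 L \<longleftrightarrow>
    (\<forall>s T. induces s T L \<longrightarrow>
      (\<forall>\<mu> \<nu>. valuation s T \<mu> \<and> valuation s T \<nu> \<and> \<mu> \<noteq> \<nu> \<longrightarrow>
        (\<exists>\<alpha>. \<mu> \<alpha> > 0 \<and> \<nu> \<alpha> = 0)))"

end

theory Submission
  imports Defs
begin

text \<open>
  Principle (P1) holds exactly when all truth values are idempotent, and (P2) holds when negation
  is involutive: then doubling the distance between two values, by \<open>\<phi> & \<phi>\<close> or its dual, eventually
  separates them. A product chain has no idempotents besides 0 and 1, and a valuation into it
  cannot be told apart by zero tests from the Boolean valuation with the same support.

  Conversely, let a closed algebra of truth values be given. An idempotent \<open>0 < e < 1\<close> would yield
  the nonclassical extension induced by \<open>{0, e, 1}\<close>, which satisfies (P1). Otherwise closedness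
  forces iterated squares of all \<open>x < 1\<close> to converge to 0. Under this Archimedean property a
  single pair of zero divisors makes negation involutive, giving (P2); without zero divisors
  the algebra is cancellative, hence a product chain containing the powers of some \<open>0 < a < 1\<close>.
  Product logic is complete for this chain of powers: a maximal theory omitting a given formula
  defines a linear preorder of formulas, whose nonzero part is cancellative, and Fourier--Motzkin
  elimination provides integer exponents for the finitely many subformulas involved.
\<close>

section \<open>Continuous t-norms and algebras of truth values\<close>

text \<open>Both principles quantify over every algebra inducing the logic, whereas one convenient
  algebra is at hand. Idempotence and involutivity are therefore written as formulas, which carry
  them to all inducing algebras; refuting a principle needs only one algebra. Closedness matters
  because the limit of iterated squares is always idempotent in [0,1], but only a limit lying in
  \<open>T\<close> yields a subalgebra \<open>{0, e, 1}\<close> and hence an extension of the given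
  logic. Product logic is given by axioms, and \<open>T\<close> may be as small as the powers of one
  element with 0. Completeness for the real product t-norm would thus not place the logic of
  \<open>T\<close> inside product logic; integer exponents are required. A linear theory may be
  non-Archimedean and have no faithful integer exponents, but refuting one formula involves only
  finitely many relations among its subformulas.\<close>

primrec eval_form :: "(real \<Rightarrow> real \<Rightarrow> real) \<Rightarrow> (nat \<Rightarrow> real) \<Rightarrow> form \<Rightarrow> real" where
  "eval_form s v (Var n) = v n"
| "eval_form s v (\<alpha> \<^bold>\<rightarrow> \<beta>) = residuum s (eval_form s v \<alpha>) (eval_form s v \<beta>)"
| "eval_form s v (\<alpha> \<^bold>& \<beta>) = s (eval_form s v \<alpha>) (eval_form s v \<beta>)"
| "eval_form s v \<^bold>\<bottom> = 0"

section \<open>Residuated arithmetic of a continuous t-norm\<close>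

locale continuous_tnorm =
  fixes s :: "real \<Rightarrow> real \<Rightarrow> real"
  assumes tnorm: "tnorm s"
begin

abbreviation res where "res \<equiv> residuum s"

lemma conj_in [simp]: "a \<in> {0..1} \<Longrightarrow> b \<in> {0..1} \<Longrightarrow> s a b \<in> {0..1}"
  and conj_assoc: "a \<in> {0..1} \<Longrightarrow> b \<in> {0..1} \<Longrightarrow> c \<in> {0..1} \<Longrightarrow> s (s a b) c = s a (s b c)"
  and conj_commute: "a \<in> {0..1} \<Longrightarrow> b \<in> {0..1} \<Longrightarrow> s a b = s b a"
  and conj_1_right [simp]: "a \<in> {0..1} \<Longrightarrow> s a 1 = a"
  and conj_1_left [simp]: "a \<in> {0..1} \<Longrightarrow> s 1 a = a"
  and conj_mono_left: "a \<in> {0..1} \<Longrightarrow> b \<in> {0..1} \<Longrightarrow> c \<in> {0..1} \<Longrightarrow> a \<le> b \<Longrightarrow> s a c \<le> s b c"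
  and conj_mono_right: "a \<in> {0..1} \<Longrightarrow> b \<in> {0..1} \<Longrightarrow> c \<in> {0..1} \<Longrightarrow> a \<le> b \<Longrightarrow> s c a \<le> s c b"
  and continuous_conj: "continuous_on ({0..1} \<times> {0..1}) (\<lambda>(a, b). s a b)"
  using tnorm unfolding tnorm_def by blast+

lemma conj_le_left: "a \<in> {0..1} \<Longrightarrow> b \<in> {0..1} \<Longrightarrow> s a b \<le> a"
  using conj_mono_right[of b 1 a] by auto

lemma conj_le_right: "a \<in> {0..1} \<Longrightarrow> b \<in> {0..1} \<Longrightarrow> s a b \<le> b"
  using conj_mono_left[of a 1 b] by auto

lemma conj_0_right [simp]: "a \<in> {0..1} \<Longrightarrow> s a 0 = 0"
  using conj_le_right[of a 0] conj_in[of a 0] by auto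

lemma conj_0_left [simp]: "a \<in> {0..1} \<Longrightarrow> s 0 a = 0"
  using conj_le_left[of 0 a] conj_in[of 0 a] by auto

lemma conj_eq_1_iff: "a \<in> {0..1} \<Longrightarrow> b \<in> {0..1} \<Longrightarrow> s a b = 1 \<longleftrightarrow> a = 1 \<and> b = 1"
  using conj_le_right[of a b] conj_le_left[of a b] by auto

lemma continuous_conj_right:
  assumes "a \<in> {0..1}" shows "continuous_on {0..1} (s a)"
proof -
  have "continuous_on {0..1} ((\<lambda>(a, b). s a b) \<circ> (\<lambda>b. (a, b)))"
    by (rule continuous_on_compose)
      (use assms in \<open>auto intro!: continuous_intros continuous_on_subset[OF continuous_conj]\<close>)
  then show ?thesis by (simp add: comp_def)
qed

text \<open>Continuity makes the candidate set compact, and it contains 0, so the maximum behind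
  \<open>GREATEST\<close> is attained.\<close>

lemma residuum_exists:
  assumes "a \<in> {0..1}" "b \<in> {0..1}"
  shows "\<exists>r. r \<in> {0..1} \<and> s a r \<le> b \<and> (\<forall>c\<in>{0..1}. s a c \<le> b \<longrightarrow> c \<le> r)"
proof -
  let ?S = "{c \<in> {0..1}. s a c \<le> b}"
  have "closed ?S"
    using continuous_closed_preimage[OF continuous_conj_right[OF assms(1)], of "{..b}"]
    by (simp add: vimage_def Int_def)
  moreover have "bounded ?S" by (rule bounded_subset[of "{0..1}"]) auto
  ultimately have "compact ?S" by (simp add: compact_eq_bounded_closed)
  moreover have "0 \<in> ?S" using assms by simp
  ultimately obtain r where "r \<in> ?S" "\<forall>c\<in>?S. c \<le> r"
    using compact_attains_sup[of ?S] by blast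
  then show ?thesis by blast
qed

lemma
  assumes "a \<in> {0..1}" "b \<in> {0..1}"
  shows res_in [simp]: "res a b \<in> {0..1}"
    and conj_res_le: "s a (res a b) \<le> b"
    and res_greatest: "c \<in> {0..1} \<Longrightarrow> s a c \<le> b \<Longrightarrow> c \<le> res a b"
proof -
  obtain r where r: "r \<in> {0..1}" "s a r \<le> b" "\<forall>c\<in>{0..1}. s a c \<le> b \<longrightarrow> c \<le> r"
    using residuum_exists[OF assms] by blast
  have "res a b = r"
    unfolding residuum_def by (rule Greatest_equality) (use r in auto)
  with r show "res a b \<in> {0..1}" "s a (res a b) \<le> b"
    "c \<in> {0..1} \<Longrightarrow> s a c \<le> b \<Longrightarrow> c \<le> res a b" by auto
qed

lemma residuation:
  assumes "a \<in> {0..1}" "b \<in> {0..1}" "c \<in> {0..1}"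
  shows "s a c \<le> b \<longleftrightarrow> c \<le> res a b"
  using assms res_greatest conj_res_le conj_mono_right res_in by (meson order_trans)

lemma res_eq_1_iff: "a \<in> {0..1} \<Longrightarrow> b \<in> {0..1} \<Longrightarrow> res a b = 1 \<longleftrightarrow> a \<le> b"
  using residuation[of a b 1] res_in[of a b] by auto

lemma le_res: "a \<in> {0..1} \<Longrightarrow> b \<in> {0..1} \<Longrightarrow> b \<le> res a b"
  using residuation[of a b b] conj_le_right by auto

lemma res_1_left [simp]: "b \<in> {0..1} \<Longrightarrow> res 1 b = b"
  using conj_res_le[of 1 b] le_res[of 1 b] res_in[of 1 b] conj_1_left[of "res 1 b"] by auto

lemma res_antimono:
  assumes "a \<in> {0..1}" "b \<in> {0..1}" "c \<in> {0..1}" "a \<le> b"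
  shows "res b c \<le> res a c"
  using assms residuation[of a c "res b c"] conj_mono_left[of a b "res b c"] conj_res_le[of b c]
    res_in[of b c] by (meson order_trans)

text \<open>By residuation both sides have the same lower bounds in the unit interval, so each is
  below the other.\<close>

lemma res_conj:
  assumes "a \<in> {0..1}" "b \<in> {0..1}" "c \<in> {0..1}"
  shows "res (s a b) c = res a (res b c)"
proof -
  have "d \<le> res (s a b) c \<longleftrightarrow> d \<le> res a (res b c)" if "d \<in> {0..1}" for d
  proof -
    have "s (s a b) d = s b (s a d)"
      using that assms by (metis conj_assoc conj_commute)
    then show ?thesis
      using residuation[of "s a b" c d] residuation[of b c "s a d"] residuation[of a "res b c" d]
        that assms conj_in res_in by metis
  qed
  from this[of "res (s a b) c"] this[of "res a (res b c)"] show ?thesis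
    using assms conj_in res_in by (metis order_antisym order_refl)
qed

text \<open>Continuity again: \<open>s a\<close> runs from 0 to \<open>a\<close>, so by the
  intermediate value theorem it takes the value \<open>b\<close>, and the residuum dominates any
  such preimage.\<close>

lemma divisibility:
  assumes "a \<in> {0..1}" "b \<in> {0..1}" "b \<le> a"
  shows "s a (res a b) = b"
proof -
  obtain c where c: "0 \<le> c" "c \<le> 1" "s a c = b"
    using IVT'[of "s a" 0 b 1] continuous_conj_right[of a] assms by auto
  then have "c \<le> res a b" using assms residuation[of a b c] by auto
  then have "b \<le> s a (res a b)" using c assms conj_mono_right[of c "res a b" a] res_in[of a b]
    by auto
  with conj_res_le[OF assms(1,2)] show ?thesis by (rule order_antisym)
qed

lemma conj_res_eq_min:
  assumes "a \<in> {0..1}" "b \<in> {0..1}"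
  shows "s a (res a b) = min a b"
  using assms divisibility[of a b] res_eq_1_iff[of a b] by (cases "a \<le> b") auto

text \<open>An element below \<open>e\<close> is a multiple of \<open>e\<close> by divisibility, and
  a further factor \<open>e\<close> is absorbed.\<close>

lemma idempotent_conj:
  assumes "e \<in> {0..1}" "x \<in> {0..1}" "s e e = e"
  shows "s e x = min e x"
proof (cases "e \<le> x")
  case True
  then have "e \<le> s e x" using assms conj_mono_right[of e x e] by auto
  with True assms conj_le_left[of e x] show ?thesis by auto
next
  case False
  then have x: "x = s e (res e x)" using assms divisibility[of e x] by auto
  have "s e (s e (res e x)) = s e (res e x)"
    using assms by (metis conj_assoc res_in)
  then show ?thesis using False x by simp
qed

text \<open>The iterated squares decrease, hence converge; continuity identifies the limit of the
  shifted sequence with the square of the limit.\<close>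

lemma limit_of_squares_idempotent:
  assumes "x \<in> {0..1}"
  obtains e where "(\<lambda>n. ((\<lambda>y. s y y) ^^ n) x) \<longlonglongrightarrow> e" "e \<in> {0..1}" "s e e = e" "e \<le> x"
proof -
  define y where "y n = ((\<lambda>y. s y y) ^^ n) x" for n
  have y: "y n \<in> {0..1}" for n
    by (induction n) (use assms in \<open>simp_all add: y_def del: atLeastAtMost_iff\<close>)
  have Suc: "y (Suc n) = s (y n) (y n)" for n by (simp add: y_def)
  have dec: "decseq y" by (rule decseq_SucI) (simp only: Suc conj_le_left[OF y y])
  obtain e where e: "y \<longlonglongrightarrow> e" "\<And>n. e \<le> y n"
    using decseq_convergent[OF dec, of 0] y by auto
  have e01: "e \<in> {0..1}"
    using closed_sequentially[of "{0..1}" y e] y e by auto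
  have "((\<lambda>(a, b). s a b) \<circ> (\<lambda>n. (y n, y n))) \<longlonglongrightarrow> (\<lambda>(a, b). s a b) (e, e)"
    using continuous_conj[unfolded continuous_on_sequentially, rule_format,
        of "(e, e)" "\<lambda>n. (y n, y n)"] e01 y e by (auto intro: tendsto_Pair)
  then have "(\<lambda>n. y (Suc n)) \<longlonglongrightarrow> s e e" by (simp add: Suc comp_def)
  moreover have "(\<lambda>n. y (Suc n)) \<longlonglongrightarrow> e" by (rule LIMSEQ_Suc[OF e(1)])
  ultimately have "s e e = e" by (rule LIMSEQ_unique)
  moreover have "e \<le> x" using e(2)[of 0] by (simp add: y_def)
  ultimately show thesis using that e e01 unfolding y_def by blast
qed

end

section \<open>Valuations into a subalgebra\<close>

locale truth_value_algebra = continuous_tnorm +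
  fixes T :: "real set"
  assumes truth_algebra: "truth_algebra s T"

lemma truth_algebra_locale: "truth_algebra s T \<Longrightarrow> truth_value_algebra s T"
  by (simp add: truth_value_algebra_def continuous_tnorm_def truth_value_algebra_axioms_def
      truth_algebra_def)

context truth_value_algebra
begin

lemma T_subset: "x \<in> T \<Longrightarrow> x \<in> {0..1}"
  and zero_in [simp]: "0 \<in> T" and one_in [simp]: "1 \<in> T"
  and conj_closed [simp]: "a \<in> T \<Longrightarrow> b \<in> T \<Longrightarrow> s a b \<in> T"
  and res_closed [simp]: "a \<in> T \<Longrightarrow> b \<in> T \<Longrightarrow> res a b \<in> T"
  using truth_algebra unfolding truth_algebra_def by blast+

lemma squares_in: "x \<in> T \<Longrightarrow> ((\<lambda>y. s y y) ^^ n) x \<in> T"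
  by (induction n) auto

lemma eval_form_in: "(\<And>n. v n \<in> T) \<Longrightarrow> eval_form s v \<alpha> \<in> T"
  by (induction \<alpha>) auto

lemma valuation_eval_form: "(\<And>n. v n \<in> T) \<Longrightarrow> valuation s T (eval_form s v)"
  by (simp add: valuation_def eval_form_in)

context
  fixes \<mu> assumes \<mu>: "valuation s T \<mu>"
begin

lemma valuation_in: "\<mu> \<alpha> \<in> T"
  and valuation_conj: "\<mu> (\<alpha> \<^bold>& \<beta>) = s (\<mu> \<alpha>) (\<mu> \<beta>)"
  and valuation_imp: "\<mu> (\<alpha> \<^bold>\<rightarrow> \<beta>) = res (\<mu> \<alpha>) (\<mu> \<beta>)"
  and valuation_falsum: "\<mu> \<^bold>\<bottom> = 0"
  using \<mu> by (auto simp: valuation_def)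

lemma valuation_in_unit: "\<mu> \<alpha> \<in> {0..1}"
  using valuation_in T_subset by blast

lemma valuation_neg: "\<mu> (\<^bold>\<not> \<alpha>) = res (\<mu> \<alpha>) 0"
  by (simp add: Neg_def valuation_imp valuation_falsum)

lemma valuation_wconj: "\<mu> (\<alpha> \<^bold>\<and> \<beta>) = min (\<mu> \<alpha>) (\<mu> \<beta>)"
  by (simp add: WConj_def valuation_imp valuation_conj conj_res_eq_min valuation_in_unit
      del: atLeastAtMost_iff)

text \<open>By symmetry let \<open>a\<close> be the smaller value. The first conjunct is then
  \<open>res 1 b\<close>, which is \<open>b\<close>, and the second is at least \<open>b\<close> by
  residuation.\<close>

lemma valuation_wdisj: "\<mu> (\<alpha> \<^bold>\<or> \<beta>) = max (\<mu> \<alpha>) (\<mu> \<beta>)"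
proof -
  let ?a = "\<mu> \<alpha>" and ?b = "\<mu> \<beta>"
  have "min (res (res a b) b) (res (res b a) a) = max a b"
    if "a \<le> b" "a \<in> {0..1}" "b \<in> {0..1}" for a b
  proof -
    have 1: "res a b = 1" using that res_eq_1_iff by blast
    have "s (res b a) b \<le> a"
      using that conj_res_le[of b a] conj_commute[of b "res b a"] res_in[of b a] by simp
    then have "b \<le> res (res b a) a" using that residuation[of "res b a" a b] res_in[of b a] by simp
    then show ?thesis using 1 that by simp
  qed
  from this[of ?a ?b] this[of ?b ?a]
  have "min (res (res ?a ?b) ?b) (res (res ?b ?a) ?a) = max ?a ?b"
    using valuation_in_unit[of \<alpha>] valuation_in_unit[of \<beta>]
    by (metis linorder_le_cases max.commute min.commute)
  then show ?thesis by (simp add: WDisj_def valuation_wconj valuation_imp)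
qed

lemma valuation_wdisj_eq_1: "\<mu> (\<alpha> \<^bold>\<or> \<beta>) = 1 \<longleftrightarrow> \<mu> \<alpha> = 1 \<or> \<mu> \<beta> = 1"
  using valuation_in_unit[of \<alpha>] valuation_in_unit[of \<beta>] by (auto simp: valuation_wdisj max_def)

lemma valuation_imp_eq_1: "\<mu> (\<alpha> \<^bold>\<rightarrow> \<beta>) = 1 \<longleftrightarrow> \<mu> \<alpha> \<le> \<mu> \<beta>"
  using valuation_in_unit valuation_imp res_eq_1_iff by simp

lemma valuation_iff_eq_1: "\<mu> (\<alpha> \<^bold>\<leftrightarrow> \<beta>) = 1 \<longleftrightarrow> \<mu> \<alpha> = \<mu> \<beta>"
  using conj_eq_1_iff[OF valuation_in_unit valuation_in_unit, of "\<alpha> \<^bold>\<rightarrow> \<beta>" "\<beta> \<^bold>\<rightarrow> \<alpha>"]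
  by (auto simp: Iff_def valuation_conj valuation_imp_eq_1)

lemma valuation_subst: "valuation s T (\<lambda>\<alpha>. \<mu> (subst_form \<sigma> \<alpha>))"
  by (simp add: valuation_def valuation_in valuation_conj valuation_imp valuation_falsum)

end

text \<open>Soundness of \<open>BL\<close> enters as an assumption: it comes with the given
  real-valued logic and passes to the logics of subalgebras.\<close>

lemma logic_of_extension:
  assumes "BL \<subseteq> logic_of s T" "M \<subseteq> logic_of s T"
  shows "extension_of (logic_of s T) M"
  unfolding extension_of_def
proof (intro conjI allI impI ballI)
  have v: "valuation s T (eval_form s (\<lambda>_. 0))" by (rule valuation_eval_form) simp
  then have "\<^bold>\<bottom> \<notin> logic_of s T" by (force simp: logic_of_def)
  then show "logic_of s T \<noteq> UNIV" by blast
next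
  fix \<alpha> assume "logic_of s T \<turnstile>\<^sub>B\<^sub>L \<alpha>"
  then show "\<alpha> \<in> logic_of s T"
  proof induction
    case (ax \<alpha>)
    then show ?case using assms(1) BL_consequence.ax by (auto simp: BL_def)
  next
    case (mp \<alpha> \<beta>)
    show ?case unfolding logic_of_def
    proof (intro CollectI allI impI)
      fix \<mu> assume \<mu>: "valuation s T \<mu>"
      then have "\<mu> \<alpha> = 1" "\<mu> (\<alpha> \<^bold>\<rightarrow> \<beta>) = 1" using mp by (auto simp: logic_of_def)
      then show "\<mu> \<beta> = 1"
        using valuation_imp_eq_1[OF \<mu>] valuation_in_unit[OF \<mu>, of \<beta>] by auto
    qed
  qed
next
  fix \<sigma> \<alpha> assume "\<alpha> \<in> logic_of s T"
  then show "subst_form \<sigma> \<alpha> \<in> logic_of s T"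
    using valuation_subst by (auto simp: logic_of_def)
qed (rule assms)

lemma Var_instance:
  assumes "x \<in> T"
  obtains \<mu> where "valuation s T \<mu>" "\<mu> (Var 0) = x"
proof
  show "valuation s T (eval_form s (\<lambda>_. x))" by (rule valuation_eval_form) (rule assms)
qed simp

text \<open>Membership of a formula depends on the logic alone, so this transfers idempotence
  between any two algebras inducing it.\<close>

lemma idempotent_from_logic:
  assumes "Var 0 \<^bold>\<leftrightarrow> (Var 0 \<^bold>& Var 0) \<in> logic_of s T" "x \<in> T"
  shows "s x x = x"
proof -
  obtain \<mu> where \<mu>: "valuation s T \<mu>" "\<mu> (Var 0) = x" using Var_instance[OF assms(2)] .
  with assms(1) have "\<mu> (Var 0 \<^bold>\<leftrightarrow> (Var 0 \<^bold>& Var 0)) = 1" by (auto simp: logic_of_def)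
  then show ?thesis using \<mu> valuation_iff_eq_1[OF \<mu>(1)] valuation_conj[OF \<mu>(1)] by simp
qed

lemma involutive_from_logic:
  assumes "\<^bold>\<not> \<^bold>\<not> (Var 0) \<^bold>\<leftrightarrow> Var 0 \<in> logic_of s T" "x \<in> T"
  shows "res (res x 0) 0 = x"
proof -
  obtain \<mu> where \<mu>: "valuation s T \<mu>" "\<mu> (Var 0) = x" using Var_instance[OF assms(2)] .
  with assms(1) have "\<mu> (\<^bold>\<not> \<^bold>\<not> (Var 0) \<^bold>\<leftrightarrow> Var 0) = 1" by (auto simp: logic_of_def)
  then show ?thesis using \<mu> valuation_iff_eq_1[OF \<mu>(1)] valuation_neg[OF \<mu>(1)] by simp
qed

end

lemma tnorm_min: "tnorm min"
  unfolding tnorm_def case_prod_beta by (auto intro!: continuous_intros)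

lemma residuum_min:
  "residuum min 0 0 = (1 :: real)" "residuum min 0 1 = (1 :: real)"
  "residuum min 1 0 = (0 :: real)" "residuum min 1 1 = (1 :: real)"
proof -
  interpret continuous_tnorm min by unfold_locales (rule tnorm_min)
  show "residuum min 0 0 = (1 :: real)" "residuum min 0 1 = (1 :: real)"
    "residuum min 1 0 = (0 :: real)" "residuum min 1 1 = (1 :: real)"
    using res_eq_1_iff[of 0] res_eq_1_iff[of 1] by auto
qed

lemma excluded_middle_classical: "Var 0 \<^bold>\<or> \<^bold>\<not> (Var 0) \<in> classical_logic"
  unfolding classical_logic_def logic_of_def
proof (intro CollectI allI impI)
  have "truth_algebra min {0, 1}"
    using tnorm_min residuum_min by (auto simp: truth_algebra_def)
  then interpret truth_value_algebra min "{0, 1}"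
    using tnorm_min by unfold_locales
  fix \<mu> assume \<mu>: "valuation min {0, 1} \<mu>"
  show "\<mu> (Var 0 \<^bold>\<or> \<^bold>\<not> (Var 0)) = 1"
    using valuation_wdisj[OF \<mu>] valuation_neg[OF \<mu>] valuation_in[OF \<mu>, of "Var 0"] residuum_min by auto
qed

section \<open>Classical logic, Goedel chains and principle (P1)\<close>

context truth_value_algebra
begin

text \<open>Excluded middle makes \<open>x\<close> or its negation equal to 1, which leaves only 0
  and 1; conversely the operations on these two values are forced.\<close>

lemma classical_iff: "logic_of s T = classical_logic \<longleftrightarrow> T = {0, 1}"
proof
  note r = residuum_min
  show "T = {0, 1}" if "logic_of s T = classical_logic"
  proof -
    have "x = 0 \<or> x = 1" if x: "x \<in> T" for x
    proof -
      obtain \<mu> where \<mu>: "valuation s T \<mu>" "\<mu> (Var 0) = x" using Var_instance[OF x] .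
      have "\<mu> (Var 0 \<^bold>\<or> \<^bold>\<not> (Var 0)) = 1" using excluded_middle_classical \<mu> \<open>logic_of s T = classical_logic\<close> by (auto simp: logic_of_def)
      then have "x = 1 \<or> res x 0 = 1"
        using valuation_wdisj_eq_1[OF \<mu>(1)] valuation_neg[OF \<mu>(1)] \<mu>(2) by simp
      then show ?thesis using res_eq_1_iff[of x 0] T_subset[OF x] by auto
    qed
    then show ?thesis by auto
  qed
  show "logic_of s T = classical_logic" if T: "T = {0, 1}"
  proof -
    have r': "res 0 0 = 1" "res 0 1 = 1" "res 1 0 = 0" "res 1 1 = 1"
      using res_eq_1_iff[of 0] res_eq_1_iff[of 1] res_1_left by auto
    have e: "s x y = min x y" "res x y = residuum min x y" if "x \<in> T" "y \<in> T" for x y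
      using that r r' T by auto
    have "valuation s T \<mu> \<longleftrightarrow> valuation min {0, 1} \<mu>" for \<mu>
      by (auto simp: valuation_def e[symmetric] T)
    then show ?thesis by (simp add: logic_of_def classical_logic_def)
  qed
qed

lemma idempotent_conj_eq_min:
  assumes "\<And>x. x \<in> T \<Longrightarrow> s x x = x" "x \<in> T" "y \<in> T"
  shows "s x y = min x y"
  using assms idempotent_conj T_subset by blast

lemma idempotent_res:
  assumes "\<And>x. x \<in> T \<Longrightarrow> s x x = x" "x \<in> T" "y \<in> T" "y < x"
  shows "res x y = y"
proof -
  have "min x (res x y) = min x y"
    using assms idempotent_conj_eq_min[OF assms(1), of x "res x y"] conj_res_eq_min T_subset by simp
  then show ?thesis using assms(4) by (auto simp: min_def split: if_splits)
qed

text \<open>A formula and its square take the value 1 together, so (P1) makes them equivalent.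
  Conversely, idempotence forces the Goedel operations in every inducing algebra.\<close>

lemma P1_iff_idempotent:
  assumes "L = logic_of s T"
  shows "P1 L \<longleftrightarrow> (\<forall>x\<in>T. s x x = x)"
proof
  have ind: "induces s T L" using assms truth_algebra by (simp add: induces_def)
  assume "P1 L"
  moreover have "\<mu> (Var 0) = 1 \<longleftrightarrow> \<mu> (Var 0 \<^bold>& Var 0) = 1" if "valuation s T \<mu>" for \<mu>
    using that by (simp add: valuation_conj conj_eq_1_iff[OF valuation_in_unit valuation_in_unit])
  ultimately have "Var 0 \<^bold>\<leftrightarrow> (Var 0 \<^bold>& Var 0) \<in> L"
    using ind unfolding P1_def by blast
  then show "\<forall>x\<in>T. s x x = x" using idempotent_from_logic assms by simp
next
  assume id: "\<forall>x\<in>T. s x x = x"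
  have idL: "Var 0 \<^bold>\<leftrightarrow> (Var 0 \<^bold>& Var 0) \<in> L"
    unfolding assms logic_of_def
  proof (intro CollectI allI impI)
    fix \<mu> assume \<mu>: "valuation s T \<mu>"
    then show "\<mu> (Var 0 \<^bold>\<leftrightarrow> (Var 0 \<^bold>& Var 0)) = 1"
      using id valuation_iff_eq_1[OF \<mu>] valuation_conj[OF \<mu>] valuation_in[OF \<mu>] by simp
  qed
  show "P1 L" unfolding P1_def
  proof (intro allI impI)
    fix s' T' \<alpha> \<beta>
    assume "induces s' T' L"
    then have L: "L = logic_of s' T'" and "truth_algebra s' T'" by (auto simp: induces_def)
    then interpret A: truth_value_algebra s' T' using truth_algebra_locale by blast
    have id': "s' x x = x" if "x \<in> T'" for x
      using A.idempotent_from_logic that idL L by simp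
    note mn = A.idempotent_conj_eq_min[OF id'] and rs = A.idempotent_res[OF id']
    \<comment> \<open>Collapsing the upper set of a positive value to 1 is an endomorphism of a Goedel chain.\<close>
    have collapse: "valuation s' T' (\<lambda>\<gamma>. if t \<le> \<mu> \<gamma> then 1 else \<mu> \<gamma>)"
      if \<mu>: "valuation s' T' \<mu>" and t: "0 < t" for t \<mu>
    proof -
      have 1: "(if t \<le> s' x y then 1 else s' x y) =
          s' (if t \<le> x then 1 else x) (if t \<le> y then 1 else y)" if "x \<in> T'" "y \<in> T'" for x y
        using that A.T_subset[of x] A.T_subset[of y] by (auto simp: mn)
      have 2: "(if t \<le> residuum s' x y then 1 else residuum s' x y) =
          residuum s' (if t \<le> x then 1 else x) (if t \<le> y then 1 else y)" if xy: "x \<in> T'" "y \<in> T'" for x y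
      proof (cases "x \<le> y")
        case True
        then have "residuum s' x y = 1" using A.res_eq_1_iff A.T_subset xy by blast
        moreover have "residuum s' (if t \<le> x then 1 else x) (if t \<le> y then 1 else y) = 1"
          using True A.T_subset[OF xy(1)] A.T_subset[OF xy(2)] by (subst A.res_eq_1_iff) auto
        ultimately show ?thesis by simp
      next
        case False
        then have "residuum s' x y = y" using rs xy by simp
        then show ?thesis
          using False A.T_subset[OF xy(1)] A.T_subset[OF xy(2)] xy rs[of x y]
          A.res_eq_1_iff[of 1 1] A.res_1_left[of y] by auto
      qed
      show ?thesis
        unfolding valuation_def
        using \<mu> t A.valuation_in[OF \<mu>]
        by (auto simp: A.valuation_conj[OF \<mu>] A.valuation_imp[OF \<mu>] A.valuation_falsum[OF \<mu>] 1[symmetric] 2[symmetric]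
            simp del: if_split)
    qed
    \<comment> \<open>If the inequality failed, collapsing at the threshold \<open>t\<close> = \<mu>
      \<gamma> would raise \<gamma> to 1 and leave \<delta> below 1.\<close>
    have le: "\<mu> \<gamma> \<le> \<mu> \<delta>"
      if \<mu>: "valuation s' T' \<mu>" and g: "\<And>\<mu>. valuation s' T' \<mu> \<Longrightarrow> \<mu> \<gamma> = 1 \<Longrightarrow> \<mu> \<delta> = 1" for \<mu> \<gamma> \<delta>
    proof (rule ccontr)
      assume n: "\<not> \<mu> \<gamma> \<le> \<mu> \<delta>"
      then have "0 < \<mu> \<gamma>" using A.valuation_in_unit[OF \<mu>, of \<delta>] by auto
      from g[OF collapse[OF \<mu> this]] have "\<mu> \<delta> = 1" using n by (auto split: if_splits)
      then show False using n A.valuation_in_unit[OF \<mu>, of \<gamma>] by auto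
    qed
    show "\<alpha> \<^bold>\<leftrightarrow> \<beta> \<in> L \<longleftrightarrow> (\<forall>\<mu>. valuation s' T' \<mu> \<longrightarrow> (\<mu> \<alpha> = 1 \<longleftrightarrow> \<mu> \<beta> = 1))"
    proof
      assume "\<alpha> \<^bold>\<leftrightarrow> \<beta> \<in> L"
      then have "\<mu> (\<alpha> \<^bold>\<leftrightarrow> \<beta>) = 1" if "valuation s' T' \<mu>" for \<mu>
        using that by (auto simp: L logic_of_def)
      then show "\<forall>\<mu>. valuation s' T' \<mu> \<longrightarrow> (\<mu> \<alpha> = 1 \<longleftrightarrow> \<mu> \<beta> = 1)"
        using A.valuation_iff_eq_1 by metis
    next
      assume eq: "\<forall>\<mu>. valuation s' T' \<mu> \<longrightarrow> (\<mu> \<alpha> = 1 \<longleftrightarrow> \<mu> \<beta> = 1)"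
      have "\<mu> (\<alpha> \<^bold>\<leftrightarrow> \<beta>) = 1" if \<mu>: "valuation s' T' \<mu>" for \<mu>
        using A.valuation_iff_eq_1[OF \<mu>] le[OF \<mu>, of \<alpha> \<beta>] le[OF \<mu>, of \<beta> \<alpha>] eq
        by (metis order_antisym)
      then show "\<alpha> \<^bold>\<leftrightarrow> \<beta> \<in> L" by (simp add: L logic_of_def)
    qed
  qed
qed

end

section \<open>Involutive algebras\<close>

locale MV_truth_algebra = truth_value_algebra +
  assumes involutive: "x \<in> T \<Longrightarrow> res (res x 0) 0 = x"
begin

lemma res_0_swap:
  assumes "x \<in> {0..1}" "y \<in> {0..1}"
  shows "res x (res y 0) = res y (res x 0)"
  using assms by (metis conj_commute res_conj atLeastAtMost_iff order_refl zero_le_one)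

lemma contraposition:
  assumes "x \<in> T" "y \<in> T"
  shows "res (res y 0) (res x 0) = res x y"
  using assms res_0_swap[of "res y 0" x] involutive[of y] T_subset by (metis res_closed zero_in)

text \<open>Contraposing the inner implication and currying turns the left side into the negation of
  a product which divisibility evaluates to the negation of \<open>y\<close>.\<close>

lemma res_res_eq_max:
  assumes "x \<in> T" "y \<in> T" "x \<le> y"
  shows "res (res y x) x = y"
proof -
  let ?nx = "res x 0" and ?ny = "res y 0"
  have T: "?nx \<in> T" "?ny \<in> T" using assms by auto
  have le: "?ny \<le> ?nx" using assms T_subset res_antimono[of x y 0] by auto
  have "res (res y x) x = res (res ?nx ?ny) (res ?nx 0)"
    using contraposition[of y x] involutive assms by simp
  also have "\<dots> = res (s (res ?nx ?ny) ?nx) 0"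
    using T T_subset res_conj[of "res ?nx ?ny" ?nx 0] res_closed zero_in by metis
  also have "s (res ?nx ?ny) ?nx = ?ny"
    using T T_subset divisibility[of ?nx ?ny] le conj_commute res_closed by metis
  finally show ?thesis using involutive assms by simp
qed

text \<open>Products cancel unless they are cut off at 0. Writing \<open>s x y\<close> as the
  negation of \<open>res y (res x 0)\<close> and exchanging the premises gives an instance of
  \<open>res_res_eq_max\<close>; a positive product puts \<open>y\<close> above the negation of
  \<open>x\<close>.\<close>

lemma cancellation:
  assumes "x \<in> T" "y \<in> T" "s x y > 0"
  shows "res x (s x y) = y"
proof -
  let ?nx = "res x 0" and ?ny = "res y 0"
  have T: "?nx \<in> T" "?ny \<in> T" using assms by auto
  have "\<not> y \<le> ?nx" using assms residuation[of x 0 y] T_subset by auto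
  then have le: "?nx \<le> y" by simp
  have "s x y = res (res (s x y) 0) 0" using assms involutive by simp
  also have "res (s x y) 0 = res y ?nx"
    using assms T_subset res_conj conj_commute zero_in by metis
  finally have "res x (s x y) = res x (res (res y ?nx) 0)" by simp
  also have "\<dots> = res (res y ?nx) ?nx"
    using res_0_swap T_subset assms T res_closed by metis
  also have "\<dots> = y" by (rule res_res_eq_max[OF T(1) assms(2) le])
  finally show ?thesis .
qed

text \<open>In the Lukasiewicz model \<open>res x y\<close> is 1 minus the distance
  \<open>x - y\<close>, so squaring it doubles the distance, up to truncation. The condition on
  \<open>y\<close> says that it is at least 1/2, so that its square is not cut off.\<close>

lemma squaring_doubles_distance:
  assumes "x \<in> T" "y \<in> T" "y \<le> x" "res y 0 \<le> y"
  shows "res (s x x) (s y y) = s (res x y) (res x y)"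
proof -
  let ?c = "res x y"
  have c: "?c \<in> T" using assms by simp
  have y: "y = s x ?c" using assms divisibility T_subset by simp
  have sq: "s y y = s (s x x) (s ?c ?c)"
  proof -
    have "s y y = s (s x ?c) (s x ?c)" using y by simp
    also have "\<dots> = s x (s (s ?c x) ?c)" using assms c T_subset by (simp add: conj_assoc)
    also have "s ?c x = s x ?c" using assms c T_subset by (intro conj_commute)
    also have "s x (s (s x ?c) ?c) = s (s x x) (s ?c ?c)" using assms c T_subset by (simp add: conj_assoc)
    finally show ?thesis .
  qed
  show ?thesis
  proof (cases "s y y > 0")
    case True
    with sq show ?thesis using cancellation[of "s x x" "s ?c ?c"] assms c by simp
  next
    case False
    \<comment> \<open>Here \<open>y\<close> is its own negation and the goal reduces to
      \<open>s ?c ?c = ?u\<close>. Unfolding this fixed point gives \<open>?c = res ?c ?u\<close>,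
      and divisibility finishes.\<close>
    let ?u = "res (s x x) 0"
    have u: "?u \<in> T" using assms by simp
    have "s y y = 0" using False T_subset[of "s y y"] assms by auto
    then have "y \<le> res y 0" using residuation[of y 0 y] T_subset assms by auto
    with assms have "y = res y 0" by simp
    also have "\<dots> = res (s x ?c) 0" using y by simp
    also have "\<dots> = res x (res ?c 0)" using assms c T_subset res_conj zero_in by metis
    finally have "?c = res x (res x (res ?c 0))" by simp
    also have "\<dots> = res (s x x) (res ?c 0)" using assms c T_subset res_conj res_closed zero_in by metis
    also have "\<dots> = res ?c ?u" using assms c T_subset res_0_swap conj_closed by metis
    finally have eq: "?c = res ?c ?u" .
    have "?u \<le> ?c"
    proof (rule ccontr)
      assume n: "\<not> ?u \<le> ?c"
      then have "res ?c ?u = 1" using res_eq_1_iff[OF T_subset[OF c] T_subset[OF u]] by simp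
      with eq n T_subset[OF u] show False by simp
    qed
    then have "s ?c (res ?c ?u) = ?u" using divisibility T_subset c u by metis
    with eq \<open>s y y = 0\<close> show ?thesis by simp
  qed
qed

text \<open>The limit \<open>e\<close> need not lie in \<open>T\<close>, but its idempotence gives
  that the minimum of \<open>e\<close> and \<open>res x 0\<close> is at most
  \<open>s x (res x 0)\<close>, which is 0. As \<open>res x 0\<close> is positive, \<open>e\<close>
  is 0. Once a square lies below \<open>res x 0\<close>, the next one is 0.\<close>

lemma squares_vanish:
  assumes "x \<in> T" "x < 1"
  obtains n where "((\<lambda>y. s y y) ^^ n) x = 0"
proof -
  have nx: "res x 0 \<in> T" using assms by simp
  obtain e where e: "(\<lambda>n. ((\<lambda>y. s y y) ^^ n) x) \<longlonglongrightarrow> e" "e \<in> {0..1}" "s e e = e" "e \<le> x"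
    using limit_of_squares_idempotent T_subset assms(1) by blast
  have "res x 0 \<noteq> 0"
    using involutive[OF assms(1)] assms(2) res_eq_1_iff[of 0 0] by auto
  then have pos: "0 < res x 0" using T_subset[OF nx] by auto
  have "s e (res x 0) \<le> s x (res x 0)"
    using e assms nx T_subset by (intro conj_mono_left) auto
  also have "\<dots> \<le> 0" using assms T_subset conj_res_le by auto
  finally have "min e (res x 0) \<le> 0" using idempotent_conj[OF e(2) T_subset[OF nx] e(3)] by simp
  with pos e have "e = 0" by auto
  with e(1) pos have "\<forall>\<^sub>F n in sequentially. ((\<lambda>y. s y y) ^^ n) x < res x 0"
    using order_tendstoD(2) by blast
  then obtain n where n: "((\<lambda>y. s y y) ^^ n) x < res x 0"
    by (auto simp: eventually_sequentially)
  let ?y = "((\<lambda>y. s y y) ^^ n) x"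
  have y: "?y \<in> T" by (rule squares_in[OF assms(1)])
  have "((\<lambda>y. s y y) ^^ k) x \<le> x" for k
  proof (induction k)
    case (Suc k)
    then show ?case
      using conj_le_left[OF T_subset T_subset, OF squares_in squares_in, OF assms(1) assms(1), of k k]
      by simp
  qed simp
  then have "s ?y ?y \<le> s x (res x 0)"
    using n y nx assms T_subset conj_mono_left[of ?y x ?y] conj_mono_right[of ?y "res x 0" x]
    by (meson less_imp_le order_trans)
  also have "\<dots> \<le> 0" using assms T_subset conj_res_le by auto
  finally have "((\<lambda>y. s y y) ^^ Suc n) x = 0" using y T_subset[of "s ?y ?y"] by simp
  then show thesis by (rule that)
qed

text \<open>\<open>n\<close> bounds the number of doublings of the distance still needed; at
  residuum 0 the formula itself separates.\<close>

lemma separating_formula_lt: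
  assumes \<mu>: "valuation s T \<mu>" and \<nu>: "valuation s T \<nu>"
  shows "((\<lambda>y. s y y) ^^ n) (res (\<mu> \<phi>) (\<nu> \<phi>)) = 0 \<Longrightarrow> \<nu> \<phi> < \<mu> \<phi> \<Longrightarrow> \<exists>\<alpha>. \<mu> \<alpha> > 0 \<and> \<nu> \<alpha> = 0"
proof (induction n arbitrary: \<phi>)
  case 0
  then have "res (\<mu> \<phi>) (\<nu> \<phi>) = 0" by simp
  then have "\<nu> \<phi> = 0"
    using le_res[of "\<mu> \<phi>" "\<nu> \<phi>"] valuation_in_unit[OF \<mu>, of \<phi>] valuation_in_unit[OF \<nu>, of \<phi>] by auto
  with 0 show ?case by auto
next
  case (Suc n)
  let ?x = "\<mu> \<phi>" and ?y = "\<nu> \<phi>" and ?c = "res (\<mu> \<phi>) (\<nu> \<phi>)"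
  have T: "?x \<in> T" "?y \<in> T" using valuation_in \<mu> \<nu> by auto
  have step: "((\<lambda>y. s y y) ^^ n) (s ?c ?c) = 0" using Suc.prems(1) by (simp only: funpow_Suc_right comp_def)
  have vc: "\<mu> (\<phi> \<^bold>& \<phi>) = s ?x ?x" "\<nu> (\<phi> \<^bold>& \<phi>) = s ?y ?y"
    using \<mu> \<nu> by (auto simp: valuation_conj)
  \<comment> \<open>The dual of squaring: truncated doubling, which keeps track of values below 1/2,
    where the square is 0.\<close>
  let ?d = "\<^bold>\<not> (\<^bold>\<not> \<phi> \<^bold>& \<^bold>\<not> \<phi>)"
  let ?nx = "res ?x 0" and ?ny = "res ?y 0"
  have vd: "\<mu> ?d = res (s ?nx ?nx) 0" "\<nu> ?d = res (s ?ny ?ny) 0"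
    using \<mu> \<nu> by (auto simp: valuation_conj valuation_neg)
  have nT: "?nx \<in> T" "?ny \<in> T" using T by auto
  have c1: "?c \<noteq> 1" using Suc.prems(2) T T_subset res_eq_1_iff by (metis not_le)
  have cT: "?c \<in> T" "s ?c ?c \<in> T" using T by auto
  have c2: "s ?c ?c \<noteq> 1" using c1 conj_eq_1_iff T_subset[OF cT(1)] by blast
  have sq0: "s z z = 0 \<or> s z z > 0" "s z z = 0 \<longleftrightarrow> z \<le> res z 0" if "z \<in> T" for z
    using that T_subset[of z] T_subset[of "s z z"] residuation[of z 0 z] by auto
  \<comment> \<open>The smaller value is at least 1/2; or only its square vanishes and the square
    separates at once; or both squares vanish and the dual is used.\<close>
  consider "?ny \<le> ?y" | "s ?y ?y = 0" "s ?x ?x > 0" | "s ?y ?y = 0" "s ?x ?x = 0"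
    using sq0[OF T(1)] sq0[OF T(2)] by linarith
  then show ?case
  proof cases
    case 1
    have d: "res (s ?x ?x) (s ?y ?y) = s ?c ?c"
      using squaring_doubles_distance[OF T] Suc.prems(2) 1 by simp
    with c2 have "\<not> s ?x ?x \<le> s ?y ?y" using T T_subset res_eq_1_iff conj_closed by metis
    then show ?thesis using Suc.IH[of "\<phi> \<^bold>& \<phi>"] step vc d by simp
  next
    case 2
    then show ?thesis using vc by metis
  next
    case 3
    then have "res ?nx 0 \<le> ?nx" using sq0 T involutive by simp
    moreover have "?nx \<le> ?ny" using res_antimono[of ?y ?x 0] Suc.prems(2) T T_subset by auto
    ultimately have "res (s ?ny ?ny) (s ?nx ?nx) = s (res ?ny ?nx) (res ?ny ?nx)"
      using squaring_doubles_distance[OF nT(2,1)] by simp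
    also have "res ?ny ?nx = ?c" using contraposition[OF T] .
    finally have "res (s ?ny ?ny) (s ?nx ?nx) = s ?c ?c" .
    then have d: "res (\<mu> ?d) (\<nu> ?d) = s ?c ?c"
      using contraposition[of "s ?ny ?ny" "s ?nx ?nx"] nT vd by simp
    with c2 have "\<not> \<mu> ?d \<le> \<nu> ?d"
      using valuation_in_unit[OF \<mu>, of ?d] valuation_in_unit[OF \<nu>, of ?d] res_eq_1_iff by metis
    then show ?thesis using Suc.IH[of ?d] step d by simp
  qed
qed

lemma separating_formula:
  assumes \<mu>: "valuation s T \<mu>" and \<nu>: "valuation s T \<nu>" and "\<mu> \<noteq> \<nu>"
  shows "\<exists>\<alpha>. \<mu> \<alpha> > 0 \<and> \<nu> \<alpha> = 0"
proof -
  have lt: ?thesis if "\<nu> \<phi> < \<mu> \<phi>" for \<phi>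
  proof -
    have u: "\<mu> \<phi> \<in> T" "\<nu> \<phi> \<in> T" using valuation_in \<mu> \<nu> by auto
    have "res (\<mu> \<phi>) (\<nu> \<phi>) \<noteq> 1" using that u T_subset res_eq_1_iff by (metis not_le)
    then have "res (\<mu> \<phi>) (\<nu> \<phi>) < 1" using u T_subset[of "res (\<mu> \<phi>) (\<nu> \<phi>)"] by auto
    then obtain n where "((\<lambda>y. s y y) ^^ n) (res (\<mu> \<phi>) (\<nu> \<phi>)) = 0"
      using squares_vanish u res_closed by blast
    then show ?thesis using separating_formula_lt[OF \<mu> \<nu>] that by blast
  qed
  from \<open>\<mu> \<noteq> \<nu>\<close> obtain \<phi> where "\<mu> \<phi> \<noteq> \<nu> \<phi>" by blast
  then consider "\<nu> \<phi> < \<mu> \<phi>" | "\<mu> \<phi> < \<nu> \<phi>" by linarith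
  then show ?thesis
  proof cases
    \<comment> \<open>Negation reverses the order, strictly because it is involutive, so \<phi> is
      replaced by its negation.\<close>
    case 2
    have u: "\<mu> \<phi> \<in> T" "\<nu> \<phi> \<in> T" using valuation_in \<mu> \<nu> by auto
    have "\<nu> (\<^bold>\<not> \<phi>) \<le> \<mu> (\<^bold>\<not> \<phi>)"
      using 2 u T_subset res_antimono[of "\<mu> \<phi>" "\<nu> \<phi>" 0] by (simp add: valuation_neg[OF \<mu>] valuation_neg[OF \<nu>])
    moreover have "\<nu> (\<^bold>\<not> \<phi>) \<noteq> \<mu> (\<^bold>\<not> \<phi>)"
      using involutive u 2 by (metis valuation_neg \<mu> \<nu> less_irrefl)
    ultimately show ?thesis using lt[of "\<^bold>\<not> \<phi>"] by simp
  qed (rule lt)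
qed

text \<open>The double negation law is a formula of the logic, so every other inducing algebra is
  involutive as well.\<close>

lemma P2_logic: "P2 (logic_of s T)"
  unfolding P2_def
proof (intro allI impI, elim conjE)
  fix s' T' \<mu> \<nu>
  assume "induces s' T' (logic_of s T)"
  then have L: "logic_of s T = logic_of s' T'" and "truth_algebra s' T'" by (auto simp: induces_def)
  then interpret A: truth_value_algebra s' T' using truth_algebra_locale by blast
  have "\<^bold>\<not> \<^bold>\<not> (Var 0) \<^bold>\<leftrightarrow> Var 0 \<in> logic_of s T"
    unfolding logic_of_def
  proof (intro CollectI allI impI)
    fix \<mu> assume \<mu>: "valuation s T \<mu>"
    show "\<mu> (\<^bold>\<not> \<^bold>\<not> (Var 0) \<^bold>\<leftrightarrow> Var 0) = 1"
      using valuation_iff_eq_1[OF \<mu>] valuation_neg[OF \<mu>] involutive[OF valuation_in[OF \<mu>]] by simp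
  qed
  then have "\<And>x. x \<in> T' \<Longrightarrow> residuum s' (residuum s' x 0) 0 = x"
    using A.involutive_from_logic L by simp
  then interpret A: MV_truth_algebra s' T' by unfold_locales
  assume "valuation s' T' \<mu>" "valuation s' T' \<nu>" "\<mu> \<noteq> \<nu>"
  then show "\<exists>\<alpha>. \<mu> \<alpha> > 0 \<and> \<nu> \<alpha> = 0" by (rule A.separating_formula)
qed

end

section \<open>Fourier--Motzkin elimination\<close>

text \<open>The choice of the value of one eliminated variable: the midpoint of the sharpest bounds.
  The flags mark strict bounds.\<close>

lemma rational_between_bounds:
  fixes A B :: "(rat \<times> bool) set"
  assumes "finite A" "finite B"
    and "\<And>l b u c. (l, b) \<in> A \<Longrightarrow> (u, c) \<in> B \<Longrightarrow> l \<le> u \<and> (b \<or> c \<longrightarrow> l < u)"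
  obtains t where "\<And>l b. (l, b) \<in> A \<Longrightarrow> l \<le> t \<and> (b \<longrightarrow> l < t)"
    "\<And>u c. (u, c) \<in> B \<Longrightarrow> t \<le> u \<and> (c \<longrightarrow> t < u)"
proof (cases "A = {} \<or> B = {}")
  case True
  then consider "A = {}" | "B = {}" by blast
  then show thesis
  proof cases
    case 1
    \<comment> \<open>The inserted 0 keeps the minimum defined when \<open>B\<close> is empty
      too.\<close>
    have "Min (insert 0 (fst ` B)) - 1 < u" if "(u, c) \<in> B" for u c
    proof -
      have "Min (insert 0 (fst ` B)) \<le> u" using assms(2) that by (intro Min_le) force+
      then show ?thesis by simp
    qed
    then show thesis using 1 that[of "Min (insert 0 (fst ` B)) - 1"] by (fastforce intro: less_imp_le)
  next
    case 2
    have "u < Max (insert 0 (fst ` A)) + 1" if "(u, c) \<in> A" for u c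
    proof -
      have "u \<le> Max (insert 0 (fst ` A))" using assms(1) that by (intro Max_ge) force+
      then show ?thesis by simp
    qed
    then show thesis using 2 that[of "Max (insert 0 (fst ` A)) + 1"] by (fastforce intro: less_imp_le)
  qed
next
  case False
  let ?l = "Max (fst ` A)" and ?u = "Min (fst ` B)"
  have "?l \<in> fst ` A" "?u \<in> fst ` B" using assms False by (auto intro!: Max_in Min_in)
  then obtain b c where bc: "(?l, b) \<in> A" "(?u, c) \<in> B" by force
  have l: "l \<le> ?l" if "(l, b) \<in> A" for l b using assms(1) that by (intro Max_ge) force+
  have u: "?u \<le> u" if "(u, c) \<in> B" for u c using assms(2) that by (intro Min_le) force+
  show thesis
  proof (rule that[of "(?l + ?u) / 2"])
    fix l d assume ld: "(l, d) \<in> A"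
    have "l \<le> ?u" "d \<longrightarrow> l < ?u" using assms(3)[OF ld bc(2)] by auto
    with l[OF ld] show "l \<le> (?l + ?u) / 2 \<and> (d \<longrightarrow> l < (?l + ?u) / 2)" by auto
  next
    fix u d assume ud: "(u, d) \<in> B"
    have "?l \<le> u" "d \<longrightarrow> ?l < u" using assms(3)[OF bc(1) ud] by auto
    with u[OF ud] show "(?l + ?u) / 2 \<le> u \<and> (d \<longrightarrow> (?l + ?u) / 2 < u)" by auto
  qed
qed

lemma positive_multiple_in:
  fixes N :: "('a \<Rightarrow> int) set"
  assumes "(\<lambda>_. 0) \<in> N" and "\<And>v w. v \<in> N \<Longrightarrow> w \<in> N \<Longrightarrow> (\<lambda>i. v i + w i) \<in> N"
    and "v \<in> N" "0 \<le> k"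
  shows "(\<lambda>i. k * v i) \<in> N"
proof -
  have "(\<lambda>i. int n * v i) \<in> N" for n
  proof (induction n)
    case (Suc n)
    then show ?case using assms(2)[OF Suc assms(3)] by (simp add: algebra_simps)
  qed (use assms in simp)
  from this[of "nat k"] show ?thesis using assms(4) by simp
qed

text \<open>The flag of a constraint in \<open>C\<close> records strictness.\<close>

lemma nonneg_functional_exists:
  fixes N :: "('a \<Rightarrow> int) set"
  assumes N0: "(\<lambda>_. 0) \<in> N" and Nadd: "\<And>v w. v \<in> N \<Longrightarrow> w \<in> N \<Longrightarrow> (\<lambda>i. v i + w i) \<in> N"
    and "finite I" "finite C"
    and "\<And>v b. (v, b) \<in> C \<Longrightarrow> v \<in> N \<and> (b \<longrightarrow> (\<lambda>i. - v i) \<notin> N) \<and> (\<forall>i. i \<notin> I \<longrightarrow> v i = 0)"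
  shows "\<exists>h :: 'a \<Rightarrow> rat. \<forall>(v, b)\<in>C. 0 \<le> (\<Sum>i\<in>I. h i * of_int (v i)) \<and>
    (b \<longrightarrow> 0 < (\<Sum>i\<in>I. h i * of_int (v i)))"
  using assms(3-)
proof (induction I arbitrary: C rule: finite_induct)
  case empty
  \<comment> \<open>With no variables left only the zero vector occurs, and it cannot be strict
    since its negative lies in \<open>N\<close>.\<close>
  have "\<not> b" if "(v, b) \<in> C" for v b
  proof
    assume b
    from empty(2)[OF that] have v: "v = (\<lambda>_. 0)" by auto
    with empty(2)[OF that] \<open>b\<close> N0 show False by simp
  qed
  then show ?case by auto
next
  case (insert j I)
  have mult: "(\<lambda>i. k * v i) \<in> N" if "v \<in> N" "0 \<le> k" for k v
    by (rule positive_multiple_in) (use N0 Nadd that in auto)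
  have CN: "v \<in> N" "b \<Longrightarrow> (\<lambda>i. - v i) \<notin> N" "i \<notin> insert j I \<Longrightarrow> v i = 0" if "(v, b) \<in> C" for v b i
    using insert.prems(2)[OF that] by auto
  \<comment> \<open>Strictness survives positive combinations: adding \<open>w\<close> and
    \<open>k - 1\<close> copies of \<open>v\<close> back would put the negative of \<open>v\<close>
    into \<open>N\<close>.\<close>
  have strict: "(\<lambda>i. - (k * v i + w i)) \<notin> N"
    if v: "v \<in> N" "(\<lambda>i. - v i) \<notin> N" and w: "w \<in> N" and k: "0 < k" for v w k
  proof
    assume "(\<lambda>i. - (k * v i + w i)) \<in> N"
    from Nadd[OF Nadd[OF this w] mult[OF v(1), of "k - 1"]] k
    have "(\<lambda>i. - v i) \<in> N" by (simp add: algebra_simps)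
    with v show False by blast
  qed
  \<comment> \<open>For \<open>p j\<close> positive and \<open>q j\<close> negative both
    coefficients are positive, and coordinate \<open>j\<close> cancels. The combination is strict as
    soon as one of its parts is.\<close>
  let ?comb = "\<lambda>p q i. (- q j) * p i + p j * q i"
  define Z where "Z = {(v, b). (v, b) \<in> C \<and> v j = 0}"
  define Pos where "Pos = {(v, b). (v, b) \<in> C \<and> 0 < v j}"
  define Ng where "Ng = {(v, b). (v, b) \<in> C \<and> v j < 0}"
  define D where "D = (\<lambda>((p, b), (q, c)). (?comb p q, b \<or> c)) ` (Pos \<times> Ng)"
  have fin: "finite Z" "finite Pos" "finite Ng" "finite D"
    unfolding Z_def Pos_def Ng_def D_def
    by (auto intro!: finite_imageI finite_cartesian_product intro: finite_subset[OF _ insert.prems(1)])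
  have "\<exists>h :: 'a \<Rightarrow> rat. \<forall>(v, b)\<in>Z \<union> D. 0 \<le> (\<Sum>i\<in>I. h i * of_int (v i)) \<and>
    (b \<longrightarrow> 0 < (\<Sum>i\<in>I. h i * of_int (v i)))"
  proof (rule insert.IH)
    fix v b assume "(v, b) \<in> Z \<union> D"
    then consider "(v, b) \<in> Z"
      | p c q d where "(p, c) \<in> Pos" "(q, d) \<in> Ng" "v = ?comb p q" "b \<longleftrightarrow> c \<or> d"
      unfolding D_def by auto
    then show "v \<in> N \<and> (b \<longrightarrow> (\<lambda>i. - v i) \<notin> N) \<and> (\<forall>i. i \<notin> I \<longrightarrow> v i = 0)"
    proof cases
      case 1
      then have vb: "(v, b) \<in> C" "v j = 0" by (auto simp: Z_def)
      then have "v i = 0" if "i \<notin> I" for i using that CN(3)[OF vb(1), of i] by (cases "i = j") auto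
      with CN(1,2)[OF vb(1)] show ?thesis by blast
    next
      case 2
      have p: "(p, c) \<in> C" "0 < p j" and q: "(q, d) \<in> C" "q j < 0"
        using 2 by (auto simp: Pos_def Ng_def)
      have mp: "(\<lambda>i. (- q j) * p i) \<in> N" and mq: "(\<lambda>i. p j * q i) \<in> N"
        using mult[OF CN(1)[OF p(1)], of "- q j"] mult[OF CN(1)[OF q(1)], of "p j"] p q by auto
      have "v \<in> N" using Nadd[OF mp mq] 2 by simp
      moreover have "(\<lambda>i. - v i) \<notin> N" if b
      proof (cases c)
        case True
        then show ?thesis using strict[OF CN(1)[OF p(1)] CN(2)[OF p(1)] mq, of "- q j"] 2 q by simp
      next
        case False
        then have d using 2 \<open>b\<close> by simp
        then show ?thesis
          using strict[OF CN(1)[OF q(1)] CN(2)[OF q(1)] mp, of "p j"] 2 p by (simp add: add.commute)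
      qed
      moreover have "v i = 0" if "i \<notin> I" for i
        using that 2 CN(3)[OF p(1), of i] CN(3)[OF q(1), of i] by (cases "i = j") auto
      ultimately show ?thesis by blast
    qed
  qed (use fin in simp)
  then obtain h :: "'a \<Rightarrow> rat" where
    h: "\<And>v b. (v, b) \<in> Z \<union> D \<Longrightarrow> 0 \<le> (\<Sum>i\<in>I. h i * of_int (v i)) \<and>
      (b \<longrightarrow> 0 < (\<Sum>i\<in>I. h i * of_int (v i)))" by blast
  define S where "S v = (\<Sum>i\<in>I. h i * of_int (v i))" for v
  \<comment> \<open>The value of \<open>t\<close> at which the constraint
    \<open>t * v j + S v\<close> vanishes: a lower bound for positive \<open>v j\<close>, an upper
    bound for negative.\<close>
  define bound where "bound = (\<lambda>(v, b :: bool). (- S v / of_int (v j), b))"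
  have comb: "S (?comb p q) = of_int (- q j) * S p + of_int (p j) * S q" for p q
    unfolding S_def by (simp add: sum_distrib_left sum.distrib[symmetric] algebra_simps sum_negf[symmetric] sum_subtractf[symmetric])
  obtain t where t: "\<And>l b. (l, b) \<in> bound ` Pos \<Longrightarrow> l \<le> t \<and> (b \<longrightarrow> l < t)"
    "\<And>u c. (u, c) \<in> bound ` Ng \<Longrightarrow> t \<le> u \<and> (c \<longrightarrow> t < u)"
  proof (rule rational_between_bounds[of "bound ` Pos" "bound ` Ng"])
    fix l b u c assume "(l, b) \<in> bound ` Pos" "(u, c) \<in> bound ` Ng"
    then obtain p q where pq: "(p, b) \<in> Pos" "(q, c) \<in> Ng"
      and l: "l = - S p / of_int (p j)" and u: "u = - S q / of_int (q j)"
      unfolding bound_def by auto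
    have j: "of_int (p j) > (0 :: rat)" "of_int (q j) < (0 :: rat)" using pq by (auto simp: Pos_def Ng_def)
    have "(?comb p q, b \<or> c) \<in> D" unfolding D_def using pq by force
    then have "0 \<le> S (?comb p q) \<and> (b \<or> c \<longrightarrow> 0 < S (?comb p q))"
      unfolding S_def using h by blast
    then show "l \<le> u \<and> (b \<or> c \<longrightarrow> l < u)"
      unfolding comb l u using j by (auto simp: field_simps)
  qed (use fin that in auto)
  have sum: "(\<Sum>i\<in>insert j I. (h(j := t)) i * of_int (v i)) = t * of_int (v j) + S v" for v
    unfolding S_def using insert.hyps by (auto intro!: sum.cong)
  have "0 \<le> t * of_int (v j) + S v \<and> (b \<longrightarrow> 0 < t * of_int (v j) + S v)" if vb: "(v, b) \<in> C" for v b
  proof (cases "v j" "0 :: int" rule: linorder_cases)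
    case less
    then have "(- S v / of_int (v j), b) \<in> bound ` Ng"
      unfolding bound_def Ng_def using vb by force
    from t(2)[OF this] less show ?thesis by (auto simp: field_simps)
  next
    case equal
    then have "(v, b) \<in> Z \<union> D" using vb by (simp add: Z_def)
    from h[OF this] equal show ?thesis by (simp add: S_def)
  next
    case greater
    then have "(- S v / of_int (v j), b) \<in> bound ` Pos"
      unfolding bound_def Pos_def using vb by force
    from t(1)[OF this] greater show ?thesis by (auto simp: field_simps)
  qed
  then show ?case unfolding sum[symmetric] by blast
qed

lemma common_denominator:
  fixes h :: "'a \<Rightarrow> rat"
  assumes "finite I"
  obtains d :: int where "0 < d" "\<And>i. i \<in> I \<Longrightarrow> of_int d * h i \<in> \<int>"
proof -
  have "\<exists>d :: int. 0 < d \<and> (\<forall>i\<in>I. of_int d * h i \<in> \<int>)"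
    using assms
  proof (induction I rule: finite_induct)
    case empty
    then show ?case by (auto intro: exI[of _ 1])
  next
    case (insert j I)
    then obtain d :: int where d: "0 < d" "\<forall>i\<in>I. of_int d * h i \<in> \<int>" by blast
    obtain a b :: int where "h j = of_int a / of_int b" "0 < b"
      by (metis quotient_of_denom_pos quotient_of_div surj_pair)
    then have b: "of_int b * h j \<in> \<int>" "0 < b" by auto
    have "of_int (d * b) * h i \<in> \<int>" if "i \<in> insert j I" for i
    proof (cases "i = j")
      case True
      have "of_int d * (of_int b * h j) \<in> \<int>" by (rule Ints_mult[OF Ints_of_int b(1)])
      then show ?thesis unfolding True of_int_mult mult.assoc .
    next
      case False
      have "of_int d * h i \<in> \<int>" using d False that by simp
      from Ints_mult[OF Ints_of_int this] show ?thesis unfolding of_int_mult mult.commute[of "of_int d"] mult.assoc .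
    qed
    then show ?case using d b by (intro exI[of _ "d * b"]) auto
  qed
  then show thesis using that by blast
qed

section \<open>Completeness of product logic for the chain of powers\<close>

abbreviation product_axioms :: "form set" where
  "product_axioms \<equiv> {\<^bold>\<not> \<phi> \<^bold>\<or> ((\<phi> \<^bold>\<rightarrow> (\<phi> \<^bold>& \<psi>)) \<^bold>\<rightarrow> \<psi>) |\<phi> \<psi>. True}"

text \<open>Truth tables of the product chain of the powers of a fixed element below 1: \<open>Some n\<close> stands for the
  \<open>n\<close>-th power and \<open>None\<close> for 0.\<close>

primrec chain_conj :: "nat option \<Rightarrow> nat option \<Rightarrow> nat option" where
  "chain_conj None y = None"
| "chain_conj (Some m) y = map_option (\<lambda>n. m + n) y"

text \<open>Larger exponents mean smaller values, so truncated subtraction is the residuum: its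
  cut-off at 0 yields \<open>Some 0\<close>, the truth value 1, when the premise is below the
  conclusion.\<close>

primrec chain_imp :: "nat option \<Rightarrow> nat option \<Rightarrow> nat option" where
  "chain_imp None y = Some 0"
| "chain_imp (Some m) y = map_option (\<lambda>n. n - m) y"

primrec chain_eval :: "(nat \<Rightarrow> nat option) \<Rightarrow> form \<Rightarrow> nat option" where
  "chain_eval v (Var n) = v n"
| "chain_eval v (\<alpha> \<^bold>\<rightarrow> \<beta>) = chain_imp (chain_eval v \<alpha>) (chain_eval v \<beta>)"
| "chain_eval v (\<alpha> \<^bold>& \<beta>) = chain_conj (chain_eval v \<alpha>) (chain_eval v \<beta>)"
| "chain_eval v \<^bold>\<bottom> = None"

lemma BL_axiom_chain_eval: "BL_axiom \<alpha> \<Longrightarrow> chain_eval v \<alpha> = Some 0"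
proof (induction rule: BL_axiom.induct)
  case (A1 \<phi> \<psi> \<theta>)
  show ?case by (cases "chain_eval v \<phi>"; cases "chain_eval v \<psi>"; cases "chain_eval v \<theta>") auto
next
  case (A2 \<phi> \<psi>)
  show ?case by (cases "chain_eval v \<phi>"; cases "chain_eval v \<psi>") auto
next
  case (A3 \<phi> \<psi>)
  show ?case by (cases "chain_eval v \<phi>"; cases "chain_eval v \<psi>") auto
next
  case (A4 \<phi> \<psi>)
  show ?case by (cases "chain_eval v \<phi>"; cases "chain_eval v \<psi>") auto
next
  case (A5a \<phi> \<psi> \<theta>)
  show ?case by (cases "chain_eval v \<phi>"; cases "chain_eval v \<psi>"; cases "chain_eval v \<theta>") auto
next
  case (A5b \<phi> \<psi> \<theta>)
  show ?case by (cases "chain_eval v \<phi>"; cases "chain_eval v \<psi>"; cases "chain_eval v \<theta>") auto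
next
  case (A6 \<phi> \<psi> \<theta>)
  show ?case by (cases "chain_eval v \<phi>"; cases "chain_eval v \<psi>"; cases "chain_eval v \<theta>") auto
next
  case (A7 \<phi>)
  show ?case by simp
qed

text \<open>Serves to tell product logic apart from classical logic.\<close>

lemma product_logic_sound:
  assumes "\<alpha> \<in> product_logic"
  shows "chain_eval v \<alpha> = Some 0"
proof -
  have "product_axioms \<turnstile>\<^sub>B\<^sub>L \<alpha>" using assms by (simp add: product_logic_def)
  then show ?thesis
  proof induction
    case (hyp \<alpha>)
    then obtain \<phi> \<psi> where "\<alpha> = \<^bold>\<not> \<phi> \<^bold>\<or> ((\<phi> \<^bold>\<rightarrow> (\<phi> \<^bold>& \<psi>)) \<^bold>\<rightarrow> \<psi>)" by blast
    then show ?case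
      by (cases "chain_eval v \<phi>"; cases "chain_eval v \<psi>") (auto simp: Neg_def WDisj_def WConj_def)
  next
    case (ax \<alpha>)
    then show ?case by (rule BL_axiom_chain_eval)
  next
    case (mp \<alpha> \<beta>)
    then show ?case by (cases "chain_eval v \<beta>") auto
  qed
qed

section \<open>Theories of BL and their linear extensions\<close>

locale BL_theory =
  fixes F :: "form set"
  assumes axioms: "BL_axiom \<alpha> \<Longrightarrow> \<alpha> \<in> F"
    and mp: "\<alpha> \<in> F \<Longrightarrow> \<alpha> \<^bold>\<rightarrow> \<beta> \<in> F \<Longrightarrow> \<beta> \<in> F"
begin

text \<open>The order of the Lindenbaum algebra, kept as a preorder on formulas instead of passing
  to a quotient. A theory need not be closed under substitution.\<close>

definition le :: "form \<Rightarrow> form \<Rightarrow> bool"  (infix \<open>\<preceq>\<close> 50)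
  where "\<phi> \<preceq> \<psi> \<longleftrightarrow> \<phi> \<^bold>\<rightarrow> \<psi> \<in> F"

lemma le_trans [trans]: "\<phi> \<preceq> \<psi> \<Longrightarrow> \<psi> \<preceq> \<theta> \<Longrightarrow> \<phi> \<preceq> \<theta>"
  unfolding le_def using axioms[OF A1] mp by blast

lemma residuation: "\<phi> \<^bold>& \<psi> \<preceq> \<theta> \<longleftrightarrow> \<phi> \<preceq> \<psi> \<^bold>\<rightarrow> \<theta>"
  unfolding le_def using axioms[OF A5a] axioms[OF A5b] mp by blast

lemma conj_le_left: "\<phi> \<^bold>& \<psi> \<preceq> \<phi>" and conj_commute: "\<phi> \<^bold>& \<psi> \<preceq> \<psi> \<^bold>& \<phi>"
  and falsum_le: "\<^bold>\<bottom> \<preceq> \<phi>"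
  unfolding le_def using axioms[OF A2] axioms[OF A3] axioms[OF A7] by auto

lemma conj_le_right: "\<phi> \<^bold>& \<psi> \<preceq> \<psi>"
  using conj_commute conj_le_left by (rule le_trans)

lemma le_of_mem: "\<psi> \<in> F \<Longrightarrow> \<phi> \<preceq> \<psi>"
  using conj_le_left[of \<psi> \<phi>] residuation mp unfolding le_def by blast

lemma le_refl [simp]: "\<phi> \<preceq> \<phi>"
proof -
  have "(\<^bold>\<bottom> \<^bold>\<rightarrow> \<^bold>\<bottom>) \<^bold>& \<phi> \<preceq> \<phi>" by (rule conj_le_right)
  then have "\<^bold>\<bottom> \<^bold>\<rightarrow> \<^bold>\<bottom> \<preceq> \<phi> \<^bold>\<rightarrow> \<phi>" by (simp add: residuation)
  then show ?thesis using falsum_le[of "\<^bold>\<bottom>"] mp unfolding le_def by blast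
qed

lemma mem_mono: "\<phi> \<in> F \<Longrightarrow> \<phi> \<preceq> \<psi> \<Longrightarrow> \<psi> \<in> F"
  unfolding le_def by (rule mp)

lemma top_mem [simp]: "\<^bold>\<bottom> \<^bold>\<rightarrow> \<^bold>\<bottom> \<in> F"
  using falsum_le le_def by blast

lemma conj_mono_left: "\<phi> \<preceq> \<psi> \<Longrightarrow> \<phi> \<^bold>& \<theta> \<preceq> \<psi> \<^bold>& \<theta>"
  by (simp add: residuation) (rule le_trans[OF _ residuation[THEN iffD1, OF le_refl]])

lemma conj_mono_right: "\<phi> \<preceq> \<psi> \<Longrightarrow> \<theta> \<^bold>& \<phi> \<preceq> \<theta> \<^bold>& \<psi>"
  by (rule le_trans[OF conj_commute le_trans[OF conj_mono_left conj_commute]])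

lemma conj_mono: "\<phi> \<preceq> \<psi> \<Longrightarrow> \<phi>' \<preceq> \<psi>' \<Longrightarrow> \<phi> \<^bold>& \<phi>' \<preceq> \<psi> \<^bold>& \<psi>'"
  by (rule le_trans[OF conj_mono_left conj_mono_right])

text \<open>Currying shows that the two bracketings have the same upper bounds; associativity
  follows by inserting each of them.\<close>

lemma conj_assoc_aux: "(\<phi> \<^bold>& \<psi>) \<^bold>& \<theta> \<preceq> \<gamma> \<longleftrightarrow> \<phi> \<^bold>& (\<psi> \<^bold>& \<theta>) \<preceq> \<gamma>"
proof -
  have "\<psi> \<^bold>\<rightarrow> (\<theta> \<^bold>\<rightarrow> \<gamma>) \<preceq> (\<psi> \<^bold>& \<theta>) \<^bold>\<rightarrow> \<gamma>" "(\<psi> \<^bold>& \<theta>) \<^bold>\<rightarrow> \<gamma> \<preceq> \<psi> \<^bold>\<rightarrow> (\<theta> \<^bold>\<rightarrow> \<gamma>)"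
    unfolding le_def using axioms[OF A5a] axioms[OF A5b] by auto
  from le_trans[OF _ this(1)] le_trans[OF _ this(2)] show ?thesis unfolding residuation by blast
qed

lemma conj_assoc: "(\<phi> \<^bold>& \<psi>) \<^bold>& \<theta> \<preceq> \<phi> \<^bold>& (\<psi> \<^bold>& \<theta>)" "\<phi> \<^bold>& (\<psi> \<^bold>& \<theta>) \<preceq> (\<phi> \<^bold>& \<psi>) \<^bold>& \<theta>"
  using conj_assoc_aux le_refl by blast+

lemma le_conj_mem: "\<psi> \<in> F \<Longrightarrow> \<phi> \<preceq> \<psi> \<^bold>& \<phi>"
proof -
  assume "\<psi> \<in> F"
  moreover have "\<psi> \<preceq> \<phi> \<^bold>\<rightarrow> (\<psi> \<^bold>& \<phi>)" using residuation le_refl by blast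
  ultimately show ?thesis using mem_mono unfolding le_def by blast
qed

lemma conj_mem: "\<phi> \<in> F \<Longrightarrow> \<psi> \<in> F \<Longrightarrow> \<phi> \<^bold>& \<psi> \<in> F"
  using le_conj_mem mem_mono by blast

lemma divisibility: "\<psi> \<preceq> \<phi> \<Longrightarrow> \<psi> \<preceq> \<phi> \<^bold>& (\<phi> \<^bold>\<rightarrow> \<psi>)"
proof -
  assume "\<psi> \<preceq> \<phi>"
  then have "\<psi> \<preceq> (\<psi> \<^bold>\<rightarrow> \<phi>) \<^bold>& \<psi>" using le_conj_mem unfolding le_def by blast
  also have "\<dots> \<preceq> \<psi> \<^bold>& (\<psi> \<^bold>\<rightarrow> \<phi>)" by (rule conj_commute)
  also have "\<dots> \<preceq> \<phi> \<^bold>& (\<phi> \<^bold>\<rightarrow> \<psi>)" unfolding le_def by (rule axioms[OF A4])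
  finally show ?thesis .
qed

lemma modus_ponens_le: "\<phi> \<^bold>& (\<phi> \<^bold>\<rightarrow> \<psi>) \<preceq> \<psi>"
  by (rule le_trans[OF conj_commute residuation[THEN iffD2, OF le_refl]])

lemma wdisj_mem:
  assumes "\<phi> \<^bold>\<or> \<psi> \<in> F"
  shows "(\<phi> \<^bold>\<rightarrow> \<psi>) \<^bold>\<rightarrow> \<psi> \<in> F" "(\<psi> \<^bold>\<rightarrow> \<phi>) \<^bold>\<rightarrow> \<phi> \<in> F"
  using mem_mono[OF assms[unfolded WDisj_def WConj_def]] conj_le_left modus_ponens_le by blast+

primrec lprod :: "form list \<Rightarrow> form" where
  "lprod [] = \<^bold>\<bottom> \<^bold>\<rightarrow> \<^bold>\<bottom>"
| "lprod (\<phi> # \<phi>s) = \<phi> \<^bold>& lprod \<phi>s"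

lemma prod_append: "lprod (xs @ ys) \<preceq> lprod xs \<^bold>& lprod ys" "lprod xs \<^bold>& lprod ys \<preceq> lprod (xs @ ys)"
proof (induction xs)
  case Nil
  show "lprod ([] @ ys) \<preceq> lprod [] \<^bold>& lprod ys" using le_conj_mem by simp
  show "lprod [] \<^bold>& lprod ys \<preceq> lprod ([] @ ys)" using conj_le_right by simp
next
  case (Cons x xs)
  show "lprod ((x # xs) @ ys) \<preceq> lprod (x # xs) \<^bold>& lprod ys"
    using le_trans[OF conj_mono_right[OF Cons(1)] conj_assoc(2)] by simp
  show "lprod (x # xs) \<^bold>& lprod ys \<preceq> lprod ((x # xs) @ ys)"
    using le_trans[OF conj_assoc(1) conj_mono_right[OF Cons(2)]] by simp
qed

lemma prod_perm: "mset xs = mset ys \<Longrightarrow> lprod xs \<preceq> lprod ys"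
proof (induction xs arbitrary: ys)
  case (Cons x xs)
  then have "x \<in> set ys" by (metis list.set_intros(1) mset_eq_setD)
  then obtain us vs where ys: "ys = us @ x # vs" by (meson split_list)
  with Cons.prems have "mset xs = mset (us @ vs)" by simp
  then have "lprod xs \<preceq> lprod (us @ vs)" by (rule Cons.IH)
  also have "\<dots> \<preceq> lprod us \<^bold>& lprod vs" by (rule prod_append)
  finally have "lprod (x # xs) \<preceq> x \<^bold>& (lprod us \<^bold>& lprod vs)" by (simp add: conj_mono_right)
  also have "\<dots> \<preceq> (x \<^bold>& lprod us) \<^bold>& lprod vs" by (rule conj_assoc)
  also have "\<dots> \<preceq> (lprod us \<^bold>& x) \<^bold>& lprod vs" by (rule conj_mono_left[OF conj_commute])
  also have "\<dots> \<preceq> lprod us \<^bold>& lprod (x # vs)" using conj_assoc(1) by simp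
  also have "\<dots> \<preceq> lprod ys" unfolding ys by (rule prod_append)
  finally show ?case .
qed simp

text \<open>The local deduction theorem: without contraction a hypothesis may be used several times,
  hence the powers. Modus ponens adds the exponents.\<close>

lemma adjoin:
  assumes "F' = {\<psi>. \<exists>n. lprod (replicate n \<phi>) \<preceq> \<psi>}"
  shows "BL_theory F'" "F \<subseteq> F'" "\<phi> \<in> F'"
proof -
  show "BL_theory F'"
  proof
    fix \<alpha> \<beta>
    show "\<alpha> \<in> F'" if "BL_axiom \<alpha>" using le_of_mem[OF axioms[OF that]] assms by blast
    assume "\<alpha> \<in> F'" "\<alpha> \<^bold>\<rightarrow> \<beta> \<in> F'"
    then obtain m n where "lprod (replicate m \<phi>) \<preceq> \<alpha>" "lprod (replicate n \<phi>) \<preceq> \<alpha> \<^bold>\<rightarrow> \<beta>"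
      using assms by blast
    from conj_mono[OF this] have "lprod (replicate (m + n) \<phi>) \<preceq> \<beta>"
      unfolding replicate_add by (rule le_trans[OF prod_append(1) le_trans[OF _ modus_ponens_le]])
    then show "\<beta> \<in> F'" using assms by blast
  qed
next
  show "F \<subseteq> F'" using le_of_mem assms by blast
  have "lprod (replicate 1 \<phi>) \<preceq> \<phi>" using conj_le_left by simp
  then show "\<phi> \<in> F'" using assms by blast
qed

text \<open>Axiom A6 allows a case split between the two implications. After \<open>m + n\<close>
  splits, the collected product contains \<open>m\<close> copies of the first or \<open>n\<close> of
  the second.\<close>

lemma prelinearity_powers:
  assumes "lprod (replicate m (\<phi> \<^bold>\<rightarrow> \<psi>)) \<preceq> \<alpha>" "lprod (replicate n (\<psi> \<^bold>\<rightarrow> \<phi>)) \<preceq> \<alpha>"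
  shows "\<alpha> \<in> F"
proof -
  let ?p = "\<phi> \<^bold>\<rightarrow> \<psi>" and ?q = "\<psi> \<^bold>\<rightarrow> \<phi>"
  have split: "\<theta> \<in> F" if "?p \<preceq> \<theta>" "?q \<preceq> \<theta>" for \<theta>
    using that axioms[OF A6] mp unfolding le_def by blast
  \<comment> \<open>\<open>k\<close> counts the splits still to be made; the claim for
    \<open>k = m + n\<close> concerns the empty product.\<close>
  have "lprod (replicate i ?p @ replicate j ?q) \<preceq> \<alpha>" if "m + n = i + j + k" for i j k
    using that
  proof (induction k arbitrary: i j)
    case 0
    then have "m \<le> i \<or> n \<le> j" by linarith
    then consider k where "i = k + m" | k where "j = n + k"
      by (metis le_Suc_ex add.commute)
    then show ?case
    proof cases
      case (1 k)
      have "lprod (replicate i ?p @ replicate j ?q) \<preceq> lprod (replicate i ?p)"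
        by (rule le_trans[OF prod_append(1) conj_le_left])
      also have "\<dots> \<preceq> lprod (replicate k ?p) \<^bold>& lprod (replicate m ?p)"
        unfolding 1 replicate_add by (rule prod_append)
      also have "\<dots> \<preceq> lprod (replicate m ?p)" by (rule conj_le_right)
      also have "\<dots> \<preceq> \<alpha>" by (rule assms)
      finally show ?thesis .
    next
      case (2 k)
      have "lprod (replicate i ?p @ replicate j ?q) \<preceq> lprod (replicate j ?q)"
        by (rule le_trans[OF prod_append(1) conj_le_right])
      also have "\<dots> \<preceq> lprod (replicate n ?q) \<^bold>& lprod (replicate k ?q)"
        unfolding 2 replicate_add by (rule prod_append)
      also have "\<dots> \<preceq> lprod (replicate n ?q)" by (rule conj_le_left)
      also have "\<dots> \<preceq> \<alpha>" by (rule assms)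
      finally show ?thesis .
    qed
  next
    case (Suc k)
    let ?w = "replicate i ?p @ replicate j ?q"
    have 1: "lprod (?p # ?w) \<preceq> \<alpha>" using Suc.IH[of "Suc i" j] Suc.prems by simp
    have "lprod (?q # ?w) \<preceq> lprod (replicate i ?p @ replicate (Suc j) ?q)" by (rule prod_perm) simp
    also have "\<dots> \<preceq> \<alpha>" using Suc.IH[of i "Suc j"] Suc.prems by simp
    finally have 2: "lprod (?q # ?w) \<preceq> \<alpha>" .
    from 1 2 have "lprod ?w \<^bold>\<rightarrow> \<alpha> \<in> F" by (intro split) (simp_all add: residuation)
    then show ?case by (simp add: le_def)
  qed
  from this[of 0 0 "m + n"] have "lprod [] \<preceq> \<alpha>" by simp
  then show ?thesis by (rule mem_mono[rotated]) simp
qed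

end

lemma linear_extension_exists:
  assumes "BL_theory F0" "\<alpha> \<notin> F0"
  obtains F where "F0 \<subseteq> F" "BL_theory F" "\<alpha> \<notin> F" "\<And>\<phi> \<psi>. \<phi> \<^bold>\<rightarrow> \<psi> \<in> F \<or> \<psi> \<^bold>\<rightarrow> \<phi> \<in> F"
proof -
  let ?A = "{F. F0 \<subseteq> F \<and> BL_theory F \<and> \<alpha> \<notin> F}"
  have "\<exists>M\<in>?A. \<forall>X\<in>?A. M \<subseteq> X \<longrightarrow> X = M"
  proof (rule subset_Zorn_nonempty)
    show "?A \<noteq> {}" using assms by blast
    fix C assume C: "C \<noteq> {}" "subset.chain ?A C"
    then have mem: "F0 \<subseteq> F" "BL_theory F" "\<alpha> \<notin> F" if "F \<in> C" for F
      using that by (auto simp: subset.chain_def)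
    have "BL_theory (\<Union>C)"
    proof
      show "\<phi> \<in> \<Union>C" if "BL_axiom \<phi>" for \<phi> using C(1) mem(2) BL_theory.axioms that by blast
      fix \<phi> \<psi> assume "\<phi> \<in> \<Union>C" "\<phi> \<^bold>\<rightarrow> \<psi> \<in> \<Union>C"
      then obtain X Y where XY: "X \<in> C" "Y \<in> C" "\<phi> \<in> X" "\<phi> \<^bold>\<rightarrow> \<psi> \<in> Y" by blast
      then have "X \<subseteq> Y \<or> Y \<subseteq> X" using C(2) by (auto simp: subset.chain_def)
      then obtain Z where "Z \<in> C" "\<phi> \<in> Z" "\<phi> \<^bold>\<rightarrow> \<psi> \<in> Z" using XY by blast
      then show "\<psi> \<in> \<Union>C" using mem(2) BL_theory.mp by blast
    qed
    then show "\<Union>C \<in> ?A" using mem C(1) by blast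
  qed
  then obtain F where FA: "F \<in> ?A" and max: "\<forall>X\<in>?A. F \<subseteq> X \<longrightarrow> X = F" by (rule bexE)
  have F: "F0 \<subseteq> F" "BL_theory F" "\<alpha> \<notin> F" using FA by simp_all
  interpret BL_theory F by (rule F)
  have adj: "\<exists>n. le (lprod (replicate n \<phi>)) \<alpha>" if "\<phi> \<notin> F" for \<phi>
  proof -
    define F' where "F' = {\<psi>. \<exists>n. le (lprod (replicate n \<phi>)) \<psi>}"
    note adj = adjoin[OF F'_def]
    have "\<alpha> \<in> F'"
    proof (rule ccontr)
      assume "\<alpha> \<notin> F'"
      then have "F' \<in> ?A" using adj(1,2) F(1) by simp
      with max adj(2) have "F' = F" by simp
      with adj(3) that show False by simp
    qed
    then show ?thesis by (simp add: F'_def)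
  qed
  \<comment> \<open>If both implications were missing, maximality would put powers of each below
    \<alpha>, and thus \<alpha> into \<open>F\<close>.\<close>
  have "\<phi> \<^bold>\<rightarrow> \<psi> \<in> F \<or> \<psi> \<^bold>\<rightarrow> \<phi> \<in> F" for \<phi> \<psi>
    using adj prelinearity_powers F(3) by blast
  with F show thesis using that by blast
qed

section \<open>Integer exponents for a linear theory of product logic\<close>

locale product_chain = BL_theory +
  assumes linear: "\<phi> \<^bold>\<rightarrow> \<psi> \<in> F \<or> \<psi> \<^bold>\<rightarrow> \<phi> \<in> F"
    and product: "\<^bold>\<not> \<phi> \<^bold>\<or> ((\<phi> \<^bold>\<rightarrow> (\<phi> \<^bold>& \<psi>)) \<^bold>\<rightarrow> \<psi>) \<in> F"
    and consistent: "\<^bold>\<bottom> \<notin> F"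
begin

abbreviation "zero \<phi> \<equiv> \<phi> \<preceq> \<^bold>\<bottom>"

lemma wdisj_memD: "\<phi> \<^bold>\<or> \<psi> \<in> F \<Longrightarrow> \<phi> \<in> F \<or> \<psi> \<in> F"
  using wdisj_mem linear mp by blast

text \<open>A linear theory is prime, and the first disjunct of the product axiom is excluded for
  nonzero \<phi>.\<close>

lemma cancel:
  assumes "\<not> zero \<phi>" "\<phi> \<^bold>& \<gamma> \<preceq> \<phi> \<^bold>& \<psi>"
  shows "\<gamma> \<preceq> \<psi>"
proof -
  have "\<phi> \<^bold>\<rightarrow> (\<phi> \<^bold>& \<psi>) \<preceq> \<psi>"
    using wdisj_memD[OF product[of \<phi> \<psi>]] assms(1) by (simp add: Neg_def le_def)
  moreover have "\<gamma> \<preceq> \<phi> \<^bold>\<rightarrow> (\<phi> \<^bold>& \<psi>)"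
    unfolding residuation[symmetric] by (rule le_trans[OF conj_commute assms(2)])
  ultimately show ?thesis by (rule le_trans[rotated])
qed

text \<open>Nonzero factors cancel from a product lying below \<phi> & falsum, so there are no zero
  divisors.\<close>

lemma zero_conj: "zero (\<phi> \<^bold>& \<psi>) \<longleftrightarrow> zero \<phi> \<or> zero \<psi>"
  using cancel[of \<phi> \<psi> "\<^bold>\<bottom>"] le_trans[OF conj_le_left[of \<phi> \<psi>]] le_trans[OF conj_le_right[of \<phi> \<psi>]]
    le_trans[OF _ falsum_le] by blast

lemma not_zero_mem: "\<phi> \<in> F \<Longrightarrow> \<not> zero \<phi>"
  using consistent mem_mono by blast

lemma zero_prod: "zero (lprod xs) \<longleftrightarrow> (\<exists>x\<in>set xs. zero x)"
  using not_zero_mem[OF top_mem] by (induction xs) (auto simp: zero_conj)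

text \<open>Differences of multisets of nonzero formulas are formal quotients of products of formulas;
  \<open>nonneg\<close> collects those at most 1, since exponents grow as truth values decrease.\<close>

definition nonneg :: "(form \<Rightarrow> int) set" where
  "nonneg = {\<lambda>\<phi>. int (count (mset xs) \<phi>) - int (count (mset ys) \<phi>) |xs ys.
    (\<forall>x\<in>set xs \<union> set ys. \<not> zero x) \<and> lprod xs \<preceq> lprod ys}"

lemma nonneg_0: "(\<lambda>_. 0) \<in> nonneg"
  unfolding nonneg_def by (rule CollectI, rule exI[of _ "[]"], rule exI[of _ "[]"]) simp

lemma nonneg_add:
  assumes "v \<in> nonneg" "w \<in> nonneg"
  shows "(\<lambda>\<phi>. v \<phi> + w \<phi>) \<in> nonneg"
proof -
  obtain xs ys xs' ys' where
    *: "v = (\<lambda>\<phi>. int (count (mset xs) \<phi>) - int (count (mset ys) \<phi>))"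
      "w = (\<lambda>\<phi>. int (count (mset xs') \<phi>) - int (count (mset ys') \<phi>))"
      "\<forall>x\<in>set xs \<union> set ys. \<not> zero x" "\<forall>x\<in>set xs' \<union> set ys'. \<not> zero x"
      "lprod xs \<preceq> lprod ys" "lprod xs' \<preceq> lprod ys'"
    using assms unfolding nonneg_def by blast
  have "lprod (xs @ xs') \<preceq> lprod (ys @ ys')"
    by (rule le_trans[OF prod_append(1) le_trans[OF conj_mono[OF *(5,6)] prod_append(2)]])
  moreover have "(\<lambda>\<phi>. v \<phi> + w \<phi>) =
      (\<lambda>\<phi>. int (count (mset (xs @ xs')) \<phi>) - int (count (mset (ys @ ys')) \<phi>))"
    unfolding * by auto
  ultimately show ?thesis unfolding nonneg_def using *(3,4) by (intro CollectI exI conjI) auto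
qed

text \<open>Supplies the strict constraints. Up to permutation the representing lists satisfy
  \<open>ys = xs @ [\<alpha>]\<close>; cancelling the nonzero product of \<open>xs\<close> would put
  \<alpha> into \<open>F\<close>.\<close>

lemma nonneg_uminus_single:
  assumes "\<not> zero \<alpha>" "\<alpha> \<notin> F"
  shows "(\<lambda>\<phi>. - int (count (mset [\<alpha>]) \<phi>)) \<notin> nonneg"
proof
  assume "(\<lambda>\<phi>. - int (count (mset [\<alpha>]) \<phi>)) \<in> nonneg"
  then obtain xs ys where
    eq: "(\<lambda>\<phi>. - int (count (mset [\<alpha>]) \<phi>)) = (\<lambda>\<phi>. int (count (mset xs) \<phi>) - int (count (mset ys) \<phi>))"
    and nz: "\<forall>x\<in>set xs \<union> set ys. \<not> zero x" and le: "lprod xs \<preceq> lprod ys"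
    unfolding nonneg_def by blast
  have "count (mset ys) \<phi> = count (mset (xs @ [\<alpha>])) \<phi>" for \<phi>
    using fun_cong[OF eq, of \<phi>] by (auto split: if_splits)
  then have "mset ys = mset (xs @ [\<alpha>])" by (rule multiset_eqI)
  then have "lprod ys \<preceq> lprod (xs @ [\<alpha>])" by (rule prod_perm)
  also have "\<dots> \<preceq> lprod xs \<^bold>& lprod [\<alpha>]" by (rule prod_append)
  also have "\<dots> \<preceq> lprod xs \<^bold>& \<alpha>" using conj_le_left by (simp add: conj_mono_right)
  finally have "lprod xs \<preceq> lprod xs \<^bold>& \<alpha>" by (rule le_trans[OF le])
  then have "lprod xs \<^bold>& (\<^bold>\<bottom> \<^bold>\<rightarrow> \<^bold>\<bottom>) \<preceq> lprod xs \<^bold>& \<alpha>" by (rule le_trans[OF conj_le_left])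
  then have "\<^bold>\<bottom> \<^bold>\<rightarrow> \<^bold>\<bottom> \<preceq> \<alpha>" using cancel nz zero_prod by blast
  then show False using assms(2) mem_mono top_mem by blast
qed

text \<open>Bounding the list lengths leaves finitely many constraints for the elimination; a common
  denominator then makes the rational solution integral.\<close>

lemma nonneg_weights:
  assumes "finite I" "\<And>\<phi>. \<phi> \<in> I \<Longrightarrow> \<not> zero \<phi>"
  obtains w :: "form \<Rightarrow> nat" where
    "\<And>xs ys. set xs \<union> set ys \<subseteq> I \<Longrightarrow> length xs \<le> k \<Longrightarrow> length ys \<le> k \<Longrightarrow> lprod xs \<preceq> lprod ys \<Longrightarrow>
      sum_list (map w ys) \<le> sum_list (map w xs)"
    "\<And>\<phi>. \<phi> \<in> I \<Longrightarrow> \<phi> \<notin> F \<Longrightarrow> 0 < w \<phi>"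
proof -
  let ?v = "\<lambda>xs ys \<phi>. int (count (mset xs) \<phi>) - int (count (mset ys) \<phi>)"
  \<comment> \<open>\<open>Suc k\<close> admits singletons even for \<open>k = 0\<close>; comparing
    them with the empty list makes all weights nonnegative.\<close>
  let ?L = "{xs. set xs \<subseteq> I \<and> length xs \<le> Suc k}"
  define C where "C = {(?v xs ys, False) |xs ys. xs \<in> ?L \<and> ys \<in> ?L \<and> lprod xs \<preceq> lprod ys} \<union>
    {(?v [\<phi>] [], True) |\<phi>. \<phi> \<in> I \<and> \<phi> \<notin> F}"
  have fin: "finite ?L" using assms(1) by (rule finite_lists_length_le)
  have "C \<subseteq> (\<lambda>(xs, ys). (?v xs ys, False)) ` (?L \<times> ?L) \<union> (\<lambda>\<phi>. (?v [\<phi>] [], True)) ` I"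
    unfolding C_def by auto
  then have finC: "finite C" by (rule finite_subset) (use fin assms(1) in auto)
  have single: "?v [\<phi>] [] \<in> nonneg" if "\<phi> \<in> I" for \<phi>
    unfolding nonneg_def
    by (intro CollectI exI[of _ "[\<phi>]"] exI[of _ "[]"]) (use that assms(2) le_of_mem in auto)
  have "\<exists>h :: form \<Rightarrow> rat. \<forall>(v, b)\<in>C. 0 \<le> (\<Sum>i\<in>I. h i * of_int (v i)) \<and>
    (b \<longrightarrow> 0 < (\<Sum>i\<in>I. h i * of_int (v i)))"
  proof (rule nonneg_functional_exists[OF nonneg_0 nonneg_add assms(1) finC])
    fix v b assume "(v, b) \<in> C"
    then consider xs ys where "v = ?v xs ys" "\<not> b" "xs \<in> ?L" "ys \<in> ?L" "lprod xs \<preceq> lprod ys"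
      | \<phi> where "v = ?v [\<phi>] []" "\<phi> \<in> I" "\<phi> \<notin> F" unfolding C_def by auto
    then show "v \<in> nonneg \<and> (b \<longrightarrow> (\<lambda>i. - v i) \<notin> nonneg) \<and> (\<forall>i. i \<notin> I \<longrightarrow> v i = 0)"
    proof cases
      case 1
      then have "v \<in> nonneg" unfolding nonneg_def using assms(2) by blast
      moreover have "v i = 0" if "i \<notin> I" for i
      proof -
        have c: "count (mset xs) i = 0" "count (mset ys) i = 0"
          using 1 that by (auto simp: count_eq_zero_iff)
        show ?thesis unfolding 1(1) c by simp
      qed
      ultimately show ?thesis using 1 by blast
    next
      case 2
      then show ?thesis
        using single[OF 2(2)] nonneg_uminus_single[of \<phi>] assms(2)[OF 2(2)] by auto
    qed
  qed
  then obtain h :: "form \<Rightarrow> rat" where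
    h: "\<And>v b. (v, b) \<in> C \<Longrightarrow> 0 \<le> (\<Sum>i\<in>I. h i * of_int (v i)) \<and>
      (b \<longrightarrow> 0 < (\<Sum>i\<in>I. h i * of_int (v i)))" by blast
  have sum: "(\<Sum>i\<in>I. h i * of_int (?v xs ys i)) = sum_list (map h xs) - sum_list (map h ys)"
    if "set xs \<subseteq> I" "set ys \<subseteq> I" for xs ys
  proof -
    have 1: "sum_list (map h zs) = (\<Sum>i\<in>I. h i * of_nat (count (mset zs) i))" if "set zs \<subseteq> I" for zs
      using that
    proof (induction zs)
      case (Cons z zs)
      then have "(\<Sum>i\<in>I. h i * of_nat (count (mset (z # zs)) i)) =
          (\<Sum>i\<in>I. h i * of_nat (count (mset zs) i) + (if z = i then h i else 0))"
        by (intro sum.cong) (auto simp: algebra_simps)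
      also have "\<dots> = sum_list (map h zs) + h z"
        using Cons assms(1) by (simp add: sum.distrib)
      finally show ?case by simp
    qed simp
    show ?thesis unfolding 1[OF that(1)] 1[OF that(2)] by (simp add: sum_subtractf right_diff_distrib)
  qed
  obtain d :: int where d: "0 < d" "\<And>i. i \<in> I \<Longrightarrow> of_int d * h i \<in> \<int>"
    using common_denominator[OF assms(1)] by blast
  have h0: "0 \<le> h \<phi>" if "\<phi> \<in> I" for \<phi>
  proof -
    have "(?v [\<phi>] [], False) \<in> C" unfolding C_def using that le_of_mem
      by (intro UnI1 CollectI exI[of _ "[\<phi>]"] exI[of _ "[]"]) auto
    from h[OF this] sum[of "[\<phi>]" "[]"] that show ?thesis by simp
  qed
  \<comment> \<open>Nothing is lost by \<open>nat\<close> and the floor: on \<open>I\<close> the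
    scaled weight is a nonnegative integer.\<close>
  define w where "w \<phi> = nat \<lfloor>of_int d * h \<phi>\<rfloor>" for \<phi>
  have w: "of_nat (w \<phi>) = of_int d * h \<phi>" if \<phi>: "\<phi> \<in> I" for \<phi>
  proof -
    obtain k where k: "of_int d * h \<phi> = of_int k" using d(2)[OF \<phi>] by (rule Ints_cases)
    have "0 \<le> of_int d * h \<phi>" using d(1) h0[OF \<phi>] by simp
    then have "0 \<le> k" unfolding k by simp
    then show ?thesis unfolding w_def k by simp
  qed
  have wsum: "of_nat (sum_list (map w xs)) = of_int d * sum_list (map h xs)" if "set xs \<subseteq> I" for xs
    using that by (induction xs) (auto simp: w distrib_left)
  show thesis
  proof
    fix xs ys assume xy: "set xs \<union> set ys \<subseteq> I" "length xs \<le> k" "length ys \<le> k" "lprod xs \<preceq> lprod ys"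
    then have "(?v xs ys, False) \<in> C" unfolding C_def by (intro UnI1) (auto intro!: exI)
    from h[OF this] have "sum_list (map h ys) \<le> sum_list (map h xs)" using sum xy by simp
    then have "(of_nat (sum_list (map w ys)) :: rat) \<le> of_nat (sum_list (map w xs))"
      using wsum xy d(1) by simp
    then show "sum_list (map w ys) \<le> sum_list (map w xs)" by (simp only: of_nat_le_iff)
  next
    fix \<phi> assume \<phi>: "\<phi> \<in> I" "\<phi> \<notin> F"
    then have "(?v [\<phi>] [], True) \<in> C" unfolding C_def by blast
    from h[OF this] have "0 < h \<phi>" using sum[of "[\<phi>]" "[]"] \<phi> by simp
    then have "(0 :: rat) < of_nat (w \<phi>)" using w[OF \<phi>(1)] d(1) by simp
    then show "0 < w \<phi>" by simp
  qed
qed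

end

primrec subformulas :: "form \<Rightarrow> form set" where
  "subformulas (Var n) = {Var n}"
| "subformulas (\<alpha> \<^bold>\<rightarrow> \<beta>) = insert (\<alpha> \<^bold>\<rightarrow> \<beta>) (subformulas \<alpha> \<union> subformulas \<beta>)"
| "subformulas (\<alpha> \<^bold>& \<beta>) = insert (\<alpha> \<^bold>& \<beta>) (subformulas \<alpha> \<union> subformulas \<beta>)"
| "subformulas \<^bold>\<bottom> = {\<^bold>\<bottom>}"

lemma finite_subformulas: "finite (subformulas \<alpha>)"
  by (induction \<alpha>) auto

lemma self_subformula: "\<alpha> \<in> subformulas \<alpha>"
  by (cases \<alpha>) auto

context product_chain
begin

text \<open>The weights of nonzero subformulas become exponents. Lists of length at most 2 express
  all that evaluation needs: order, truth and binary products.\<close>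

lemma refuting_chain_evaluation:
  assumes "\<alpha> \<notin> F"
  obtains v where "chain_eval v \<alpha> \<noteq> Some 0"
proof -
  define I where "I = {\<phi> \<in> subformulas \<alpha>. \<not> zero \<phi>}"
  have "finite I" unfolding I_def using finite_subformulas by simp
  then obtain w :: "form \<Rightarrow> nat" where
    w: "\<And>xs ys. set xs \<union> set ys \<subseteq> I \<Longrightarrow> length xs \<le> 2 \<Longrightarrow> length ys \<le> 2 \<Longrightarrow> lprod xs \<preceq> lprod ys \<Longrightarrow>
      sum_list (map w ys) \<le> sum_list (map w xs)"
    and pos: "\<And>\<phi>. \<phi> \<in> I \<Longrightarrow> \<phi> \<notin> F \<Longrightarrow> 0 < w \<phi>"
    by (rule nonneg_weights) (auto simp: I_def)
  have single: "\<phi> \<preceq> lprod [\<phi>]" "lprod [\<phi>] \<preceq> \<phi>" for \<phi>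
    using le_trans[OF le_conj_mem[OF top_mem] conj_commute] conj_le_left by simp_all
  have pair: "\<phi> \<^bold>& \<psi> \<preceq> lprod [\<phi>, \<psi>]" "lprod [\<phi>, \<psi>] \<preceq> \<phi> \<^bold>& \<psi>" for \<phi> \<psi>
    using conj_mono_right[OF single(1)] conj_mono_right[OF single(2)] by simp_all
  have w_le: "w \<psi> \<le> w \<phi>" if "\<phi> \<in> I" "\<psi> \<in> I" "\<phi> \<preceq> \<psi>" for \<phi> \<psi>
    using w[of "[\<phi>]" "[\<psi>]"] that le_trans[OF single(2) le_trans[OF that(3) single(1)]] by simp
  have w_conj: "w \<theta> = w \<phi> + w \<psi>"
    if "\<phi> \<in> I" "\<psi> \<in> I" "\<theta> \<in> I" "\<phi> \<^bold>& \<psi> \<preceq> \<theta>" "\<theta> \<preceq> \<phi> \<^bold>& \<psi>" for \<phi> \<psi> \<theta>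
    using w[of "[\<phi>, \<psi>]" "[\<theta>]"] w[of "[\<theta>]" "[\<phi>, \<psi>]"] that
      le_trans[OF pair(2) le_trans[OF that(4) single(1)]]
      le_trans[OF single(2) le_trans[OF that(5) pair(1)]] by simp
  have w_mem: "w \<phi> = 0" if "\<phi> \<in> I" "\<phi> \<in> F" for \<phi>
    using w[of "[]" "[\<phi>]"] that le_of_mem[OF conj_mem[OF that(2) top_mem]] by simp
  define v where "v n = (if zero (Var n) then None else Some (w (Var n)))" for n
  have "chain_eval v \<phi> = (if zero \<phi> then None else Some (w \<phi>))" if "subformulas \<phi> \<subseteq> subformulas \<alpha>" for \<phi>
    using that
  proof (induction \<phi>)
    case (Var n)
    then show ?case by (simp add: v_def)
  next
    case (Imp \<phi> \<psi>)
    have mem: "\<phi> \<in> subformulas \<alpha>" "\<psi> \<in> subformulas \<alpha>" "\<phi> \<^bold>\<rightarrow> \<psi> \<in> subformulas \<alpha>"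
      using Imp.prems self_subformula[of \<phi>] self_subformula[of \<psi>] by auto
    have IH: "chain_eval v \<phi> = (if zero \<phi> then None else Some (w \<phi>))"
      "chain_eval v \<psi> = (if zero \<psi> then None else Some (w \<psi>))" using Imp by auto
    show ?case
    proof (cases "\<phi> \<preceq> \<psi>")
      case True
      then have imp: "\<phi> \<^bold>\<rightarrow> \<psi> \<in> F" by (simp add: le_def)
      then have nz: "\<not> zero (\<phi> \<^bold>\<rightarrow> \<psi>)" by (rule not_zero_mem)
      then have 0: "w (\<phi> \<^bold>\<rightarrow> \<psi>) = 0" using w_mem imp mem by (simp add: I_def)
      have "zero \<psi> \<Longrightarrow> zero \<phi>" by (rule le_trans[OF True])
      then show ?thesis using nz 0 IH w_le[OF _ _ True] mem by (auto simp: I_def)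
    next
      case False
      then have le: "\<psi> \<preceq> \<phi>" using linear by (auto simp: le_def)
      have nz: "\<not> zero \<phi>" using False le_trans[OF _ falsum_le] by blast
      show ?thesis
      proof (cases "zero \<psi>")
        case True
        have "zero (\<phi> \<^bold>& (\<phi> \<^bold>\<rightarrow> \<psi>))" by (rule le_trans[OF modus_ponens_le True])
        then show ?thesis using nz True IH zero_conj by simp
      next
        case False
        have "\<psi> \<preceq> \<phi> \<^bold>\<rightarrow> \<psi>" using conj_le_left residuation by blast
        then have nzi: "\<not> zero (\<phi> \<^bold>\<rightarrow> \<psi>)" using False le_trans by blast
        \<comment> \<open>Divisibility makes \<psi> equivalent to the product of \<phi> and the
          implication, so the exponent of the implication is the difference.\<close>
        have "w \<psi> = w \<phi> + w (\<phi> \<^bold>\<rightarrow> \<psi>)"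
          by (rule w_conj) (use mem nz nzi False modus_ponens_le divisibility[OF le] in \<open>auto simp: I_def\<close>)
        then show ?thesis using nz nzi False IH by simp
      qed
    qed
  next
    case (Conj \<phi> \<psi>)
    have mem: "\<phi> \<in> subformulas \<alpha>" "\<psi> \<in> subformulas \<alpha>" "\<phi> \<^bold>& \<psi> \<in> subformulas \<alpha>"
      using Conj.prems self_subformula[of \<phi>] self_subformula[of \<psi>] by auto
    have IH: "chain_eval v \<phi> = (if zero \<phi> then None else Some (w \<phi>))"
      "chain_eval v \<psi> = (if zero \<psi> then None else Some (w \<psi>))" using Conj by auto
    show ?case
      using IH w_conj[of \<phi> \<psi> "\<phi> \<^bold>& \<psi>"] mem zero_conj[of \<phi> \<psi>] by (auto simp: I_def)
  next
    case Falsum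
    then show ?case by simp
  qed
  from this[of \<alpha>] have "chain_eval v \<alpha> \<noteq> Some 0"
    using pos[of \<alpha>] assms self_subformula by (auto simp: I_def)
  then show thesis by (rule that)
qed

end

theorem product_logic_complete:
  assumes "\<And>v. chain_eval v \<alpha> = Some 0"
  shows "\<alpha> \<in> product_logic"
proof (rule ccontr)
  assume "\<alpha> \<notin> product_logic"
  moreover have "BL_theory product_logic"
    by unfold_locales (auto simp: product_logic_def intro: BL_consequence.intros)
  ultimately obtain F where F: "product_logic \<subseteq> F" "BL_theory F" "\<alpha> \<notin> F"
    "\<And>\<phi> \<psi>. \<phi> \<^bold>\<rightarrow> \<psi> \<in> F \<or> \<psi> \<^bold>\<rightarrow> \<phi> \<in> F" using linear_extension_exists by blast
  interpret BL_theory F by (rule F(2))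
  have "\<^bold>\<bottom> \<notin> F" using mem_mono falsum_le F(3) by blast
  moreover have "\<^bold>\<not> \<phi> \<^bold>\<or> ((\<phi> \<^bold>\<rightarrow> (\<phi> \<^bold>& \<psi>)) \<^bold>\<rightarrow> \<psi>) \<in> F" for \<phi> \<psi>
    using F(1) by (auto simp: product_logic_def intro!: BL_consequence.hyp)
  ultimately interpret product_chain F using F(4) by unfold_locales
  show False using refuting_chain_evaluation[OF F(3)] assms by blast
qed

section \<open>The characterization of product logic\<close>

context truth_value_algebra
begin

lemma subalgebra_logic:
  assumes "T0 \<subseteq> T"
  shows "logic_of s T \<subseteq> logic_of s T0"
  using assms unfolding logic_of_def valuation_def by blast

lemma nonclassical_element:
  assumes "T \<noteq> {0, 1}"
  obtains a where "a \<in> T" "0 < a" "a < 1"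
proof -
  have "\<exists>a\<in>T. a \<noteq> 0 \<and> a \<noteq> 1" using assms zero_in one_in by blast
  then show thesis using that T_subset by (metis atLeastAtMost_iff order_le_less)
qed

lemma product_axiom_value:
  assumes "product_logic \<subseteq> logic_of s T" "x \<in> T" "0 < x" "y \<in> T"
  shows "res x (s x y) \<le> y"
proof -
  let ?v = "\<lambda>n :: nat. if n = 0 then x else y"
  let ?\<mu> = "eval_form s ?v" and ?\<alpha> = "\<^bold>\<not> (Var 0) \<^bold>\<or> ((Var 0 \<^bold>\<rightarrow> (Var 0 \<^bold>& Var 1)) \<^bold>\<rightarrow> Var 1)"
  have "?\<alpha> \<in> product_logic"
    unfolding product_logic_def by (intro CollectI BL_consequence.hyp) blast
  moreover have \<mu>: "valuation s T ?\<mu>" using assms by (intro valuation_eval_form) auto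
  ultimately have "?\<mu> ?\<alpha> = 1" using assms(1) by (auto simp: logic_of_def)
  then have "res x 0 = 1 \<or> res (res x (s x y)) y = 1"
    using valuation_wdisj_eq_1[OF \<mu>] valuation_neg[OF \<mu>] by simp
  moreover have "res x 0 \<noteq> 1" using assms T_subset res_eq_1_iff[of x 0] by auto
  ultimately show ?thesis
    using res_eq_1_iff T_subset assms by (metis conj_closed res_closed)
qed

lemma product_extension_fails:
  assumes "product_logic \<subseteq> logic_of s T" "logic_of s T \<noteq> classical_logic"
  shows "\<not> P1 (logic_of s T)" "\<not> P2 (logic_of s T)"
proof -
  obtain a where a: "a \<in> T" "0 < a" "a < 1"
    using nonclassical_element assms(2) classical_iff by blast
  show "\<not> P1 (logic_of s T)"
  proof
    \<comment> \<open>An idempotent \<open>a\<close> makes the premise \<open>res a (s a a)\<close>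
      of the product inequality equal to 1, forcing \<open>a\<close> up to 1.\<close>
    assume "P1 (logic_of s T)"
    then have "s a a = a" using P1_iff_idempotent a by simp
    then have "1 \<le> a"
      using product_axiom_value[OF assms(1) a(1,2) a(1)] res_eq_1_iff[of a a] T_subset[OF a(1)] by simp
    with a show False by simp
  qed
  have neg: "res x 0 = 0" if "x \<in> T" "0 < x" for x
    using product_axiom_value[OF assms(1) that zero_in] T_subset[OF that(1)]
      T_subset[OF res_closed[OF that(1) zero_in]] by simp
  let ?\<mu> = "eval_form s (\<lambda>_. a)" and ?\<nu> = "eval_form s (\<lambda>_. 1)"
  have \<mu>: "valuation s T ?\<mu>" and \<nu>: "valuation s T ?\<nu>" using a by (auto intro!: valuation_eval_form)
  \<comment> \<open>Whether a value is 0 follows the two-valued truth tables, so valuations with the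
    same support on the variables agree on all zero tests.\<close>
  have conj0: "s x y = 0 \<longleftrightarrow> x = 0 \<or> y = 0" if "x \<in> T" "y \<in> T" for x y
    using neg[OF that(1)] residuation[of x 0 y] T_subset[OF that(1)] T_subset[OF that(2)] by force
  have res0: "res x y = 0 \<longleftrightarrow> x \<noteq> 0 \<and> y = 0" if "x \<in> T" "y \<in> T" for x y
    using neg[OF that(1)] le_res[of x y] res_eq_1_iff[of 0 y] T_subset[OF that(1)] T_subset[OF that(2)] by force
  have same: "?\<mu> \<alpha> = 0 \<longleftrightarrow> ?\<nu> \<alpha> = 0" for \<alpha>
    using a by (induction \<alpha>) (simp_all add: conj0 res0 eval_form_in)
  show "\<not> P2 (logic_of s T)"
  proof
    assume "P2 (logic_of s T)"
    moreover have "induces s T (logic_of s T)" using truth_algebra by (simp add: induces_def)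
    moreover have "?\<mu> \<noteq> ?\<nu>"
    proof
      assume "?\<mu> = ?\<nu>"
      then have "?\<mu> (Var 0) = ?\<nu> (Var 0)" by (rule fun_cong)
      with a show False by simp
    qed
    ultimately obtain \<alpha> where "?\<mu> \<alpha> > 0" "?\<nu> \<alpha> = 0" using \<mu> \<nu> unfolding P2_def by blast
    with same[of \<alpha>] show False by simp
  qed
qed

text \<open>Idempotence turns the product of \<open>e\<close> and its negation, which is 0, into
  their minimum; so the negation of \<open>e\<close> is 0 and no further element arises.\<close>

lemma three_element_subalgebra:
  assumes "e \<in> T" "0 < e" "e < 1" "s e e = e"
  shows "truth_algebra s {0, e, 1}"
proof -
  have e: "e \<in> {0..1}" using assms by auto
  have "min e (res e 0) = 0"
    using idempotent_conj[OF e _ assms(4), of "res e 0"] conj_res_eq_min[OF e, of 0] res_in[OF e, of 0] assms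
    by simp
  then have "res e 0 = 0" using assms by (auto simp: min_def split: if_splits)
  moreover have "res 0 x = 1" "res x x = 1" "res x 1 = 1" if "x \<in> {0..1}" for x
    using that res_eq_1_iff[of 0 x] res_eq_1_iff[of x x] res_eq_1_iff[of x 1] by auto
  ultimately show ?thesis
    using tnorm assms e unfolding truth_algebra_def by auto
qed

lemma idempotent_extension:
  assumes "BL \<subseteq> logic_of s T" "e \<in> T" "0 < e" "e < 1" "s e e = e"
  obtains M where "real_valued_logic M" "extension_of M (logic_of s T)" "M \<noteq> classical_logic" "P1 M"
proof -
  interpret E: truth_value_algebra s "{0, e, 1}"
    by unfold_locales (rule three_element_subalgebra[OF assms(2-)])
  have sub: "logic_of s T \<subseteq> logic_of s {0, e, 1}" using assms by (intro subalgebra_logic) auto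
  have BL: "BL \<subseteq> logic_of s {0, e, 1}" using assms(1) sub by blast
  show thesis
  proof
    show "real_valued_logic (logic_of s {0, e, 1})"
      unfolding real_valued_logic_def induces_def
      using E.logic_of_extension[OF BL BL] E.truth_algebra by blast
    show "extension_of (logic_of s {0, e, 1}) (logic_of s T)"
      by (rule E.logic_of_extension[OF BL sub])
    show "logic_of s {0, e, 1} \<noteq> classical_logic" using E.classical_iff assms by (metis insertCI insertE less_irrefl singletonD)
    show "P1 (logic_of s {0, e, 1})" using E.P1_iff_idempotent assms by simp
  qed
qed

text \<open>The one use of closedness: the idempotent limit lies in \<open>T\<close>, so it is 0 or
  1, and it is at most \<open>x\<close>.\<close>

lemma squares_tendsto_0:
  assumes "closed T" "\<And>e. e \<in> T \<Longrightarrow> s e e = e \<Longrightarrow> e = 0 \<or> e = 1" "x \<in> T" "x < 1"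
  shows "(\<lambda>n. ((\<lambda>y. s y y) ^^ n) x) \<longlonglongrightarrow> 0"
proof -
  obtain e where e: "(\<lambda>n. ((\<lambda>y. s y y) ^^ n) x) \<longlonglongrightarrow> e" "s e e = e" "e \<le> x"
    using limit_of_squares_idempotent T_subset assms(3) by blast
  have "e \<in> T" using closed_sequentially[OF assms(1) _ e(1)] squares_in[OF assms(3)] by blast
  with assms(2,4) e show ?thesis by force
qed

end

section \<open>Archimedean algebras: involutive or cancellative\<close>

locale archimedean_truth_algebra = truth_value_algebra +
  assumes squares_tendsto_0: "x \<in> T \<Longrightarrow> x < 1 \<Longrightarrow> (\<lambda>n. ((\<lambda>y. s y y) ^^ n) x) \<longlonglongrightarrow> 0"
begin

lemma squares_below:
  assumes "x \<in> T" "x < 1" "0 < y"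
  obtains n where "((\<lambda>y. s y y) ^^ n) x < y"
  using order_tendstoD(2)[OF squares_tendsto_0[OF assms(1,2)] assms(3)]
  by (auto simp: eventually_sequentially)

text \<open>If \<open>a\<close> is strictly below its double negation \<open>?b\<close>, then
  \<open>a = s ?b ?c\<close> with \<open>?c\<close> below 1, while \<open>a\<close> and
  \<open>?b\<close> share the negation \<open>?u\<close>. Hence \<open>res ?c ?u = ?u\<close>, and
  likewise for all iterated squares of \<open>?c\<close>.\<close>

lemma involutive_if_zero_divisor:
  assumes "z \<in> T" "0 < z" "0 < res z 0" "a \<in> T"
  shows "res (res a 0) 0 = a"
proof (rule ccontr)
  assume neq: "res (res a 0) 0 \<noteq> a"
  let ?u = "res a 0" and ?b = "res (res a 0) 0" and ?c = "res (res (res a 0) 0) a"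
  have T: "?u \<in> T" "?b \<in> T" "?c \<in> T" using assms by auto
  have "s ?u a \<le> 0" using assms T T_subset conj_commute conj_res_le[of a 0] zero_in by metis
  then have ab: "a \<le> ?b" using residuation[of ?u 0 a] T T_subset assms by auto
  with neq have lt: "a < ?b" by simp
  then have "?c \<noteq> 1" using res_eq_1_iff T T_subset assms by (metis not_le)
  then have c1: "?c < 1" using T_subset[OF T(3)] by auto
  have "s ?u ?b \<le> 0" using T T_subset conj_res_le[of ?u 0] zero_in by metis
  then have "s ?b ?u \<le> 0" using T T_subset conj_commute by metis
  then have "?u \<le> res ?b 0" using residuation[of ?b 0 ?u] T T_subset by auto
  moreover have "res ?b 0 \<le> ?u" using res_antimono[of a ?b 0] ab T T_subset assms by auto
  ultimately have nb: "res ?b 0 = ?u" by simp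
  have "a = s ?b ?c" using divisibility[of ?b a] ab T T_subset assms by simp
  then have "?u = res (s ?c ?b) 0" using T T_subset conj_commute by metis
  also have "\<dots> = res ?c ?u" using nb T T_subset res_conj zero_in by metis
  finally have c: "res ?c ?u = ?u" by simp
  have pow: "res (((\<lambda>y. s y y) ^^ n) ?c) ?u = ?u" for n
  proof (induction n)
    case (Suc n)
    then show ?case
      using res_conj[OF T_subset T_subset T_subset, OF squares_in squares_in, OF T(3) T(3) T(1), of n n] by simp
  qed (use c in simp)
  \<comment> \<open>A square below both members of a pair with product 0 itself squares to 0; then
    \<open>?u\<close> equals \<open>res 0 ?u\<close>, that is 1, and both \<open>a\<close> and
    \<open>?b\<close> are 0.\<close>
  obtain n where n: "((\<lambda>y. s y y) ^^ n) ?c < min z (res z 0)"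
    using squares_below[OF T(3) c1, of "min z (res z 0)"] assms by auto
  let ?d = "((\<lambda>y. s y y) ^^ n) ?c"
  have d: "?d \<in> T" by (rule squares_in[OF T(3)])
  have "s ?d ?d \<le> s z (res z 0)"
    using n d assms T_subset conj_mono_left[of ?d z ?d] conj_mono_right[of ?d "res z 0" z]
    by (force intro: order_trans)
  also have "\<dots> \<le> 0" using assms T_subset conj_res_le by auto
  finally have "s ?d ?d = 0" using T_subset[of "s ?d ?d"] d by auto
  with pow[of "Suc n"] have "res 0 ?u = ?u" by simp
  then have "?u = 1" using res_eq_1_iff[of 0 ?u] T_subset[OF T(1)] by simp
  then have "a \<le> 0" "?b = 0" using res_eq_1_iff[of a 0] T_subset[OF assms(4)] by auto
  with lt T_subset[OF assms(4)] show False by simp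
qed

text \<open>If \<open>y < z\<close> give the same product \<open>?w\<close>, then \<open>?w\<close>
  absorbs \<open>?c = res z y\<close> and all its iterated squares. It lies below each of them, so
  it is 0, and hence \<open>z\<close> is 0.\<close>

lemma cancellation_if_no_zero_divisors:
  assumes neg: "\<And>x. x \<in> T \<Longrightarrow> 0 < x \<Longrightarrow> res x 0 = 0"
    and "x \<in> T" "0 < x" "y \<in> T" "z \<in> T" "s x y = s x z"
  shows "y = z"
proof -
  have "\<not> y < z" if yz: "y \<in> T" "z \<in> T" "s x y = s x z" for y z
  proof
    assume lt: "y < z"
    let ?c = "res z y" and ?w = "s x z"
    have T: "?c \<in> T" "?w \<in> T" using yz assms by auto
    have "?c \<noteq> 1" using res_eq_1_iff yz T_subset lt by (metis not_le)
    then have c1: "?c < 1" using T_subset[OF T(1)] by auto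
    have "s z ?c = y" using divisibility[of z y] lt yz T_subset by simp
    then have w: "s ?w ?c = ?w" using conj_assoc T T_subset yz assms(2) by metis
    have pow: "s ?w (((\<lambda>y. s y y) ^^ n) ?c) = ?w" for n
    proof (induction n)
      case (Suc n)
      then show ?case
        using conj_assoc[OF T_subset T_subset T_subset, OF T(2) squares_in squares_in, OF T(1) T(1), of n n] by simp
    qed (use w in simp)
    have "?w \<le> ((\<lambda>y. s y y) ^^ n) ?c" for n
      using conj_le_right[OF T_subset T_subset, OF T(2) squares_in, OF T(1), of n] pow[of n] by simp
    then have "\<not> 0 < ?w" using squares_below[OF T(1) c1] by (metis not_le)
    then have "s x z \<le> 0" by simp
    then have "z \<le> 0" using residuation[of x 0 z] neg[of x] assms(2,3) yz T_subset by auto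
    with lt T_subset[OF yz(1)] show False by simp
  qed
  from this[of y z] this[of z y] assms show ?thesis by force
qed

text \<open>The powers of \<open>a\<close> with 0 form a copy of the exponent chain in
  \<open>T\<close>, so every chain evaluation becomes a valuation and completeness applies.\<close>

lemma logic_of_subset_product_logic:
  assumes neg: "\<And>x. x \<in> T \<Longrightarrow> 0 < x \<Longrightarrow> res x 0 = 0" and a: "a \<in> T" "0 < a" "a < 1"
  shows "logic_of s T \<subseteq> product_logic"
proof
  fix \<alpha> assume \<alpha>: "\<alpha> \<in> logic_of s T"
  define p where "p n = (s a ^^ n) 1" for n
  have p_Suc: "p (Suc n) = s a (p n)" and p_0: "p 0 = 1" for n by (simp_all add: p_def)
  have pT: "p n \<in> T" for n by (induction n) (simp_all add: p_0 p_Suc a)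
  have pos: "0 < p n" for n
  proof (induction n)
    case (Suc n)
    have "\<not> p n \<le> res a 0" using Suc neg[OF a(1,2)] by simp
    then show ?case
      using residuation[of a 0 "p n"] T_subset[OF a(1)] T_subset[OF pT[of n]] by (simp add: p_Suc)
  qed (simp add: p_0)
  have p_add: "p (m + n) = s (p m) (p n)" for m n
  proof (induction m)
    case 0
    show ?case using T_subset[OF pT[of n]] by (simp add: p_0)
  next
    case (Suc m)
    then show ?case using conj_assoc[OF T_subset T_subset T_subset, OF a(1) pT pT, of m n] by (simp add: p_Suc)
  qed
  have p_anti: "p (m + n) \<le> p m" for m n
    unfolding p_add using conj_le_left pT T_subset by blast
  \<comment> \<open>For \<open>m < n\<close> divisibility and additivity give the same product with
    \<open>p m\<close> on both sides, and \<open>p m\<close> cancels.\<close>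
  have p_res: "res (p m) (p n) = p (n - m)" for m n
  proof (cases "n \<le> m")
    case True
    then show ?thesis
      using p_anti[of n "m - n"] res_eq_1_iff[OF T_subset T_subset, OF pT pT, of m n] by (simp add: p_0)
  next
    case False
    define k where "k = n - m"
    have n: "n = m + k" using False by (simp add: k_def)
    have "s (p m) (res (p m) (p n)) = s (p m) (p k)"
      using divisibility[OF T_subset T_subset, OF pT pT, of n m] p_anti[of m k]
      unfolding n p_add[symmetric] .
    then show ?thesis
      using cancellation_if_no_zero_divisors[OF neg, of "p m" "res (p m) (p n)" "p k"] pT pos n by simp
  qed
  have p_1: "p n = 1 \<longleftrightarrow> n = 0" for n
  proof (cases n)
    case (Suc k)
    then have "p n \<le> a" unfolding Suc p_Suc using conj_le_left a(1) pT T_subset by blast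
    then show ?thesis using a Suc by simp
  qed (simp add: p_0)
  define emb where "emb x = (case x of None \<Rightarrow> 0 | Some n \<Rightarrow> p n)" for x
  have emb_conj: "emb (chain_conj x y) = s (emb x) (emb y)" for x y
    by (cases x; cases y) (use T_subset[OF pT] p_add in \<open>auto simp: emb_def\<close>)
  have emb_imp: "emb (chain_imp x y) = res (emb x) (emb y)" for x y
  proof (cases x)
    case None
    have "emb y \<in> {0..1}" using T_subset[OF pT] by (cases y) (auto simp: emb_def)
    then show ?thesis using None res_eq_1_iff[of 0 "emb y"] by (simp add: emb_def p_0)
  next
    case (Some m)
    then show ?thesis by (cases y) (auto simp: emb_def p_res neg pT pos)
  qed
  have "chain_eval v \<alpha> = Some 0" for v
  proof -
    have "valuation s T (\<lambda>\<beta>. emb (chain_eval v \<beta>))"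
      unfolding valuation_def by (auto simp: emb_conj emb_imp, auto simp: emb_def pT split: option.split)
    then have "emb (chain_eval v \<alpha>) = 1" using \<alpha> by (auto simp: logic_of_def)
    then show ?thesis by (auto simp: emb_def p_1 split: option.splits)
  qed
  then show "\<alpha> \<in> product_logic" by (rule product_logic_complete)
qed

lemma product_logic_subset_logic_of:
  assumes neg: "\<And>x. x \<in> T \<Longrightarrow> 0 < x \<Longrightarrow> res x 0 = 0" and BL: "BL \<subseteq> logic_of s T"
  shows "product_logic \<subseteq> logic_of s T"
proof
  have ax: "\<^bold>\<not> \<phi> \<^bold>\<or> ((\<phi> \<^bold>\<rightarrow> (\<phi> \<^bold>& \<psi>)) \<^bold>\<rightarrow> \<psi>) \<in> logic_of s T" for \<phi> \<psi>
    unfolding logic_of_def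
  proof (intro CollectI allI impI)
    fix \<mu> assume \<mu>: "valuation s T \<mu>"
    let ?x = "\<mu> \<phi>" and ?y = "\<mu> \<psi>"
    have T: "?x \<in> T" "?y \<in> T" using valuation_in[OF \<mu>] by auto
    show "\<mu> (\<^bold>\<not> \<phi> \<^bold>\<or> ((\<phi> \<^bold>\<rightarrow> (\<phi> \<^bold>& \<psi>)) \<^bold>\<rightarrow> \<psi>)) = 1"
    proof (cases "?x = 0")
      case True
      then show ?thesis
        using valuation_wdisj_eq_1[OF \<mu>] valuation_neg[OF \<mu>, of \<phi>] res_eq_1_iff[of 0 0] by simp
    next
      case False
      then have "0 < ?x" using T_subset[OF T(1)] by auto
      moreover have "s ?x (res ?x (s ?x ?y)) = s ?x ?y"
        using divisibility[of ?x "s ?x ?y"] T_subset[OF T(1)] T_subset[OF T(2)] conj_le_left[of ?x ?y] conj_in by simp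
      ultimately have "res ?x (s ?x ?y) = ?y"
        using cancellation_if_no_zero_divisors[OF neg, of ?x "res ?x (s ?x ?y)" ?y] T by simp
      then show ?thesis
        using valuation_wdisj_eq_1[OF \<mu>] valuation_imp_eq_1[OF \<mu>] valuation_imp[OF \<mu>] valuation_conj[OF \<mu>] by simp
    qed
  qed
  fix \<alpha> assume "\<alpha> \<in> product_logic"
  then have "product_axioms \<turnstile>\<^sub>B\<^sub>L \<alpha>" by (simp add: product_logic_def)
  then have "logic_of s T \<turnstile>\<^sub>B\<^sub>L \<alpha>"
    by induction (use ax in \<open>auto intro: BL_consequence.intros\<close>)
  then show "\<alpha> \<in> logic_of s T"
    using logic_of_extension[OF BL BL] by (simp add: extension_of_def)
qed

end

text \<open>Excluded middle takes the value \<open>Some 1\<close> at exponent 1, as negation sends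
  every nonzero value to 0.\<close>

lemma product_logic_nonclassical: "product_logic \<noteq> classical_logic"
proof -
  let ?em = "Var 0 \<^bold>\<or> \<^bold>\<not> (Var 0)"
  have "chain_eval (\<lambda>_. Some 1) ?em \<noteq> Some 0"
    by (simp add: WDisj_def WConj_def Neg_def)
  then show ?thesis using product_logic_sound excluded_middle_classical by metis
qed

theorem mainTheorem3:
  fixes L :: "form set"
  assumes "real_valued_logic L" and "closed_logic L"
  shows "L = product_logic \<longleftrightarrow>
    (\<not> P1 L \<and> \<not> P2 L) \<and>
    (\<forall>M. real_valued_logic M \<and> extension_of M L \<and> M \<noteq> classical_logic \<longrightarrow>
      \<not> P1 M \<and> \<not> P2 M)"
proof
  assume L: "L = product_logic"
  \<comment> \<open>Stated for supersets of \<open>L\<close>, so that it covers \<open>L\<close>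
    itself, which is not classical, as well as the extensions.\<close>
  have fails: "\<not> P1 M \<and> \<not> P2 M"
    if M: "real_valued_logic M" "L \<subseteq> M" "M \<noteq> classical_logic" for M
  proof -
    obtain s T where "truth_algebra s T" and M_eq: "M = logic_of s T"
      using M(1) by (auto simp: real_valued_logic_def induces_def)
    then interpret truth_value_algebra s T by (simp add: truth_algebra_locale)
    show ?thesis using product_extension_fails M L M_eq by blast
  qed
  show "(\<not> P1 L \<and> \<not> P2 L) \<and>
    (\<forall>M. real_valued_logic M \<and> extension_of M L \<and> M \<noteq> classical_logic \<longrightarrow> \<not> P1 M \<and> \<not> P2 M)"
    using fails[OF assms(1)] fails product_logic_nonclassical L by (auto simp: extension_of_def)
next
  assume fails: "(\<not> P1 L \<and> \<not> P2 L) \<and>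
    (\<forall>M. real_valued_logic M \<and> extension_of M L \<and> M \<noteq> classical_logic \<longrightarrow> \<not> P1 M \<and> \<not> P2 M)"
  obtain s T where "truth_algebra s T" and L: "L = logic_of s T" and "closedin (top_of_set {0..1}) T"
    using assms(2) by (auto simp: closed_logic_def induces_def)
  then interpret truth_value_algebra s T by (simp add: truth_algebra_locale)
  have closed: "closed T"
    using \<open>closedin (top_of_set {0..1}) T\<close> closedin_closed_trans closed_atLeastAtMost by blast
  have BL: "BL \<subseteq> logic_of s T"
    using assms(1) L by (simp add: real_valued_logic_def extension_of_def)
  have "e = 0 \<or> e = 1" if e: "e \<in> T" "s e e = e" for e
  proof (rule ccontr)
    assume "\<not> (e = 0 \<or> e = 1)"
    then have "0 < e" "e < 1" using T_subset[OF e(1)] by auto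
    then obtain M where "real_valued_logic M" "extension_of M L" "M \<noteq> classical_logic" "P1 M"
      using idempotent_extension[OF BL e(1) _ _ e(2)] L by metis
    with fails show False by blast
  qed
  note arch = squares_tendsto_0[OF closed this]
  interpret archimedean_truth_algebra s T by unfold_locales (rule arch)
  have neg: "res x 0 = 0" if "x \<in> T" "0 < x" for x
  proof (rule ccontr)
    assume "res x 0 \<noteq> 0"
    then have "0 < res x 0" using T_subset[OF res_closed[OF that(1) zero_in]] by auto
    \<comment> \<open>One positive element with positive negation makes the whole algebra
      involutive, and (P2) would hold for \<open>L\<close>.\<close>
    then interpret MV_truth_algebra s T
      by unfold_locales (rule involutive_if_zero_divisor[OF that])
    show False using fails P2_logic L by simp
  qed
  \<comment> \<open>The failure of (P1) for \<open>L\<close> itself is used here: the clause on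
    extensions exempts classical logic.\<close>
  have "T \<noteq> {0, 1}"
  proof
    assume "T = {0, 1}"
    then have "P1 L" using P1_iff_idempotent[OF L] by simp
    with fails show False by blast
  qed
  then obtain a where "a \<in> T" "0 < a" "a < 1" by (rule nonclassical_element)
  then show "L = product_logic"
    using logic_of_subset_product_logic[OF neg] product_logic_subset_logic_of[OF neg BL] L by blast
qed

end
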